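(* Let $N=(N_i)_{i\ge0}$ be a reduced sequence of $(l_i\times l_{i+1})$ nonnegative real matrices with alphabets $\mathcal A=(\mathcal A_i)_{i\ge 0}$ of bounded size. Then there exists a reordering of the alphabets $\mathcal A_i$ such that the new matrix sequence is in Frobenius normal form. After some finite time, this form is unique up to a (nonstationary) permutation of the alphabets. Moreover this order can be chosen so as to place the initial streams first and the final streams last. Furthermore, there exists a gathering such that the new matrix sequence is in fixed-size Frobenius normal form for times $\ge1$; that is, $$N=\begin{bmatrix}A_1&C_{12}&\cdots&C_{1\hat l}\\ 0_{21}&A_2&&\vdots\\ \vdots&&\ddots&\\ 0_{\hat l1}&\cdots&&A_{\hat l}\end{bmatrix}.$$
   Context: $N_i$ has rows indexed by the finite nonempty set $\mathcal A_i$ and columns by $\mathcal A_{i+1}$. Reduced: no all-zero rows or columns. A sequence is primitive if for every $k$ there is $n>k$ with $N_kN_{k+1}\cdots N_n$ strictly positive. A gathering of $N$ along $0=n_0<n_1<\dots$ is the sequence $\widetilde N_k=N_{n_k}N_{n_k+1}\cdots N_{n_{k+1}-1}$. **Streams.** A stream $\alpha=(\alpha_i)_{i\ge0}$ is a sequence of subsets $\alpha_i\subseteq\mathcal A_i$. A vertex path is a sequence $x_k x_{k+1}\dots$, $x_i\in\mathcal A_i$, with $(N_i)_{x_ix_{i+1}}>0$. $\alpha$ front-connects to $\beta$ at time $k$ if there is a vertex path $x_k,y_{k+1},\dots,y_{n-1},x_n$, $n\ge k+1$, with $x_k\in\alpha_k$, $x_n\in\beta_n$, $y_i\notin\alpha_i\cup\beta_i$;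 it infinitely front-connects if this happens for arbitrarily large $k$. Among the streams given by the primitive diagonal blocks, a stream is initial if no other one infinitely front-connects to it, and final if it does not infinitely front-connect to any other one. **Block form.** For each $k$ let $\{\mathcal A_k^i\}_{i=1}^{\hat l_k}$ be a partition of $\mathcal A_k$ into possibly empty sets; the ordered set of labels $\widehat{\mathcal A}_k=\{1,\dots,\hat l_k\}$ is the block alphabet. The $(i,j)$ block of $N_k$ is the submatrix with rows $\mathcal A_k^i$ and columns $\mathcal A_{k+1}^j$; it is called virtual if $\mathcal A_k^i$ or $\mathcal A_{k+1}^j$ is empty. The block matrix $B_k$ has $(B_k)_{ij}=1$ if some entry of the $(i,j)$ block is nonzero, and $0$ otherwise (in particular for virtual blocks). Certain block indices are designated primitive; the remaining ones are pool indices. Pool blocks may be virtual; primitive blocks may be virtual before a finite starting time, and the requirements on them apply from that time on. The order on $\mathcal A_k$ is taken compatible with the block alphabet (each $\mathcal A_k^i$ is a set of consecutive letters, in the order of $i$). **Frobenius normal form.** $(N_k)$ is in Frobenius normal form with respect to this block structure if: (1) the diagonal blocks with primitive index form reduced and primitive matrix sequences, while for the other (pool) diagonal blocks the product from time $k\ge0$ to time $n>k$ is, for $n$ sufficiently large, either zero or virtual; (2) $(B_k)_{ij}=0$ for all $k\ge0$ and all $j<i$. **Fixed-size Frobenius normal form** requires bounded alphabet size, (1), (2) and: (3) the columns of $(B_k)$ which have, for all $k$, a single $1$, in entry $(i,i)$, occur first (initial blocks), and the rows which have, for all $k$, a single $1$, in entry $(i,i)$, occur last (final blocks); a block which is both is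 arbitrarily chosen to be one of these; (4) for all $k$, $N_k$ and $B_k$ are square, of dimensions $(l\times l)$ and $(\hat l\times\hat l)$ independent of $k$, with square diagonal blocks; there are no virtual blocks; and each diagonal block sequence $A_j$ is either reduced and primitive or identically zero (zero for all times).
   Formalization: Uniqueness is stated for forms whose block alphabets have bounded size (it fails otherwise), and it matches the primitive blocks and the set of all pool letters after a finite time; the division of pool letters into individual pool blocks is not unique. *)

theory Defs
  imports Complex_Main "HOL-Library.Disjoint_Sets" "HOL-Combinatorics.Permutations"
begin

text \<open>
  A matrix sequence is a pair of alphabets \<open>A k\<close> and entries \<open>N k x y\<close>, of which only
  those with \<open>x \<in> A k\<close> and \<open>y \<in> A (Suc k)\<close> are meaningful. A block is obtained by
  passing to smaller index sets while keeping \<open>N\<close>; it may have an empty index set.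
\<close>

definition matrix_sequence :: "(nat \<Rightarrow> 'a set) \<Rightarrow> (nat \<Rightarrow> 'a \<Rightarrow> 'a \<Rightarrow> real) \<Rightarrow> bool" where
  "matrix_sequence A N \<longleftrightarrow>
     (\<forall>k. finite (A k) \<and> A k \<noteq> {}) \<and> (\<forall>k. \<forall>x\<in>A k. \<forall>y\<in>A (Suc k). 0 \<le> N k x y)"

definition bounded_size :: "(nat \<Rightarrow> 'a set) \<Rightarrow> bool" where
  "bounded_size A \<longleftrightarrow> (\<exists>b. \<forall>k. finite (A k) \<and> card (A k) \<le> b)"

definition reduced :: "(nat \<Rightarrow> 'a set) \<Rightarrow> (nat \<Rightarrow> 'a \<Rightarrow> 'a \<Rightarrow> real) \<Rightarrow> bool" where
  "reduced A N \<longleftrightarrow>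
     (\<forall>k. (\<forall>x\<in>A k. \<exists>y\<in>A (Suc k). N k x y \<noteq> 0) \<and>
          (\<forall>y\<in>A (Suc k). \<exists>x\<in>A k. N k x y \<noteq> 0))"

text \<open>
  \<open>seq_prod A N k n\<close> is the product \<open>N k \<cdots> N n\<close>, both ends included, for \<open>k \<le> n\<close>. Summing
  over an empty intermediate alphabet gives \<open>0\<close>.
\<close>

primrec seq_prod ::
  "(nat \<Rightarrow> 'a set) \<Rightarrow> (nat \<Rightarrow> 'a \<Rightarrow> 'a \<Rightarrow> real) \<Rightarrow> nat \<Rightarrow> nat \<Rightarrow> 'a \<Rightarrow> 'a \<Rightarrow> real" where
  "seq_prod A N k 0 = N k"
| "seq_prod A N k (Suc n) =
     (if Suc n \<le> k then N k
      else (\<lambda>x y. \<Sum>z\<in>A (Suc n). seq_prod A N k n x z * N (Suc n) z y))"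

definition primitive :: "(nat \<Rightarrow> 'a set) \<Rightarrow> (nat \<Rightarrow> 'a \<Rightarrow> 'a \<Rightarrow> real) \<Rightarrow> bool" where
  "primitive A N \<longleftrightarrow>
     (\<forall>k. \<exists>n>k. \<forall>x\<in>A k. \<forall>y\<in>A (Suc n). 0 < seq_prod A N k n x y)"

definition gathering_times :: "(nat \<Rightarrow> nat) \<Rightarrow> bool" where
  "gathering_times t \<longleftrightarrow> t 0 = 0 \<and> strict_mono t"

definition gathered ::
  "(nat \<Rightarrow> 'a set) \<Rightarrow> (nat \<Rightarrow> 'a \<Rightarrow> 'a \<Rightarrow> real) \<Rightarrow> (nat \<Rightarrow> nat) \<Rightarrow> nat \<Rightarrow> 'a \<Rightarrow> 'a \<Rightarrow> real" where
  "gathered A N t k = seq_prod A N (t k) (t (Suc k) - 1)"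

text \<open>
  A reordering lists the letters of \<open>A k\<close> as \<open>e k 1, e k 2, \<dots>\<close>; the new alphabets are
  \<open>{1..card (A k)}\<close> with the usual order.
\<close>

definition reordering :: "(nat \<Rightarrow> 'a set) \<Rightarrow> (nat \<Rightarrow> nat \<Rightarrow> 'a) \<Rightarrow> bool" where
  "reordering A e \<longleftrightarrow> (\<forall>k. bij_betw (e k) {1..card (A k)} (A k))"

definition positions :: "(nat \<Rightarrow> 'a set) \<Rightarrow> nat \<Rightarrow> nat set" where
  "positions A k = {1..card (A k)}"

definition reordered ::
  "(nat \<Rightarrow> nat \<Rightarrow> 'a) \<Rightarrow> (nat \<Rightarrow> 'a \<Rightarrow> 'a \<Rightarrow> real) \<Rightarrow> nat \<Rightarrow> nat \<Rightarrow> nat \<Rightarrow> real" where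
  "reordered e N k x y = N k (e k x) (e (Suc k) y)"


subsection \<open>Streams\<close>

definition vertex_path ::
  "(nat \<Rightarrow> 'a set) \<Rightarrow> (nat \<Rightarrow> 'a \<Rightarrow> 'a \<Rightarrow> real) \<Rightarrow> nat \<Rightarrow> nat \<Rightarrow> (nat \<Rightarrow> 'a) \<Rightarrow> bool" where
  "vertex_path A N k n x \<longleftrightarrow>
     (\<forall>i\<in>{k..n}. x i \<in> A i) \<and> (\<forall>i\<in>{k..<n}. 0 < N i (x i) (x (Suc i)))"

definition front_connects_at ::
  "(nat \<Rightarrow> 'a set) \<Rightarrow> (nat \<Rightarrow> 'a \<Rightarrow> 'a \<Rightarrow> real) \<Rightarrow> (nat \<Rightarrow> 'a set) \<Rightarrow> (nat \<Rightarrow> 'a set) \<Rightarrow> nat \<Rightarrow> bool"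
  where
  "front_connects_at A N \<alpha> \<beta> k \<longleftrightarrow>
     (\<exists>n x. k < n \<and> vertex_path A N k n x \<and> x k \<in> \<alpha> k \<and> x n \<in> \<beta> n \<and>
        (\<forall>i\<in>{k<..<n}. x i \<notin> \<alpha> i \<union> \<beta> i))"

definition infinitely_front_connects ::
  "(nat \<Rightarrow> 'a set) \<Rightarrow> (nat \<Rightarrow> 'a \<Rightarrow> 'a \<Rightarrow> real) \<Rightarrow> (nat \<Rightarrow> 'a set) \<Rightarrow> (nat \<Rightarrow> 'a set) \<Rightarrow> bool" where
  "infinitely_front_connects A N \<alpha> \<beta> \<longleftrightarrow> (\<forall>m. \<exists>k\<ge>m. front_connects_at A N \<alpha> \<beta> k)"


subsection \<open>Block form\<close>

text \<open>
  \<open>lh k\<close> is the size of the block alphabet \<open>{1..lh k}\<close> at time \<open>k\<close> and \<open>blk k i\<close> is the set of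
  letters with label \<open>i\<close> at that time; it is empty when \<open>i\<close> is not a label at time \<open>k\<close>.
  The last condition says that the order of the letters is compatible with the block alphabet.
  As blocks may be empty, bounded alphabets do not force \<open>lh\<close> to be bounded, and for unbounded
  \<open>lh\<close> normal forms are not unique: placing all letters of \<open>A k\<close> in the label \<open>k + 1\<close>
  makes all diagonal blocks virtual. Boundedness of \<open>lh\<close> therefore has to be asked for separately.
\<close>

definition block_structure ::
  "(nat \<Rightarrow> 'a::linorder set) \<Rightarrow> (nat \<Rightarrow> nat) \<Rightarrow> (nat \<Rightarrow> nat \<Rightarrow> 'a set) \<Rightarrow> bool" where
  "block_structure A lh blk \<longleftrightarrow>
     (\<forall>k. (\<Union>i\<in>{1..lh k}. blk k i) = A k \<and>
          disjoint_family_on (blk k) {1..lh k} \<and>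
          (\<forall>i. i \<notin> {1..lh k} \<longrightarrow> blk k i = {}) \<and>
          (\<forall>i j. i < j \<longrightarrow> (\<forall>x\<in>blk k i. \<forall>y\<in>blk k j. x < y)))"

definition virtual_block :: "(nat \<Rightarrow> nat \<Rightarrow> 'a set) \<Rightarrow> nat \<Rightarrow> nat \<Rightarrow> nat \<Rightarrow> bool" where
  "virtual_block blk k i j \<longleftrightarrow> blk k i = {} \<or> blk (Suc k) j = {}"

definition block_matrix ::
  "(nat \<Rightarrow> 'a \<Rightarrow> 'a \<Rightarrow> real) \<Rightarrow> (nat \<Rightarrow> nat \<Rightarrow> 'a set) \<Rightarrow> nat \<Rightarrow> nat \<Rightarrow> nat \<Rightarrow> nat" where
  "block_matrix N blk k i j = (if \<exists>x\<in>blk k i. \<exists>y\<in>blk (Suc k) j. N k x y \<noteq> 0 then 1 else 0)"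

definition stream :: "(nat \<Rightarrow> nat \<Rightarrow> 'a set) \<Rightarrow> nat \<Rightarrow> nat \<Rightarrow> 'a set" where
  "stream blk i k = blk k i"

text \<open>Primitive blocks are virtual before their starting time \<open>s\<close>, possibly \<open>0\<close>.\<close>

definition primitive_from ::
  "(nat \<Rightarrow> 'a \<Rightarrow> 'a \<Rightarrow> real) \<Rightarrow> (nat \<Rightarrow> nat \<Rightarrow> 'a set) \<Rightarrow> nat \<Rightarrow> nat \<Rightarrow> bool" where
  "primitive_from N blk i s \<longleftrightarrow>
     (\<forall>k<s. virtual_block blk k i i) \<and>
     (\<forall>k\<ge>s. blk k i \<noteq> {}) \<and>
     reduced (\<lambda>k. blk (s + k) i) (\<lambda>k. N (s + k)) \<and>
     primitive (\<lambda>k. blk (s + k) i) (\<lambda>k. N (s + k))"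

definition pool_block ::
  "(nat \<Rightarrow> 'a \<Rightarrow> 'a \<Rightarrow> real) \<Rightarrow> (nat \<Rightarrow> nat \<Rightarrow> 'a set) \<Rightarrow> nat \<Rightarrow> bool" where
  "pool_block N blk i \<longleftrightarrow>
     (\<forall>k. \<exists>m>k. \<forall>n\<ge>m.
        blk k i = {} \<or> blk (Suc n) i = {} \<or>
        (\<forall>x\<in>blk k i. \<forall>y\<in>blk (Suc n) i. seq_prod (stream blk i) N k n x y = 0))"

text \<open>\<open>P\<close> is the set of block indices designated primitive; the others are pool indices.\<close>

definition frobenius_normal_form ::
  "(nat \<Rightarrow> 'a::linorder set) \<Rightarrow> (nat \<Rightarrow> 'a \<Rightarrow> 'a \<Rightarrow> real) \<Rightarrow>
   (nat \<Rightarrow> nat) \<Rightarrow> (nat \<Rightarrow> nat \<Rightarrow> 'a set) \<Rightarrow> nat set \<Rightarrow> bool" where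
  "frobenius_normal_form A N lh blk P \<longleftrightarrow>
     block_structure A lh blk \<and> P \<subseteq> (\<Union>k. {1..lh k}) \<and>
     (\<forall>i\<in>P. \<exists>s. primitive_from N blk i s) \<and>
     (\<forall>i\<in>(\<Union>k. {1..lh k}) - P. pool_block N blk i) \<and>
     (\<forall>k. \<forall>i\<in>{1..lh k}. \<forall>j\<in>{1..lh (Suc k)}. j < i \<longrightarrow> block_matrix N blk k i j = 0)"

definition initial_indices ::
  "(nat \<Rightarrow> 'a set) \<Rightarrow> (nat \<Rightarrow> 'a \<Rightarrow> 'a \<Rightarrow> real) \<Rightarrow> (nat \<Rightarrow> nat \<Rightarrow> 'a set) \<Rightarrow> nat set \<Rightarrow> nat set" where
  "initial_indices A N blk P =
     {i\<in>P. \<forall>j\<in>P - {i}. \<not> infinitely_front_connects A N (stream blk j) (stream blk i)}"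

definition final_indices ::
  "(nat \<Rightarrow> 'a set) \<Rightarrow> (nat \<Rightarrow> 'a \<Rightarrow> 'a \<Rightarrow> real) \<Rightarrow> (nat \<Rightarrow> nat \<Rightarrow> 'a set) \<Rightarrow> nat set \<Rightarrow> nat set" where
  "final_indices A N blk P =
     {i\<in>P. \<forall>j\<in>P - {i}. \<not> infinitely_front_connects A N (stream blk i) (stream blk j)}"

text \<open>Every index which is both initial and final is assigned to exactly one of \<open>I\<close> and \<open>F\<close>.\<close>

definition extremal_choice :: "nat set \<Rightarrow> nat set \<Rightarrow> nat set \<Rightarrow> nat set \<Rightarrow> bool" where
  "extremal_choice Init Fin I F \<longleftrightarrow>
     I \<subseteq> Init \<and> F \<subseteq> Fin \<and> I \<inter> F = {} \<and> I \<union> F = Init \<union> Fin"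

text \<open>
  The comparison is between letters, against all other letters including those of pool blocks.
  Comparing labels would be too strong: letters occurring before the starting times need
  smaller labels than the initial streams into which they lead.
\<close>

definition initial_first_final_last ::
  "(nat \<Rightarrow> 'a::linorder set) \<Rightarrow> (nat \<Rightarrow> 'a \<Rightarrow> 'a \<Rightarrow> real) \<Rightarrow>
   (nat \<Rightarrow> nat \<Rightarrow> 'a set) \<Rightarrow> nat set \<Rightarrow> bool" where
  "initial_first_final_last A N blk P \<longleftrightarrow>
     (\<exists>I F. extremal_choice (initial_indices A N blk P) (final_indices A N blk P) I F \<and>
        (\<forall>k. (\<forall>x\<in>(\<Union>i\<in>I. blk k i). \<forall>y\<in>A k - (\<Union>i\<in>I. blk k i). x < y) \<and>
             (\<forall>y\<in>(\<Union>i\<in>F. blk k i). \<forall>x\<in>A k - (\<Union>i\<in>F. blk k i). x < y)))"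

definition initial_columns ::
  "(nat \<Rightarrow> 'a \<Rightarrow> 'a \<Rightarrow> real) \<Rightarrow> (nat \<Rightarrow> nat \<Rightarrow> 'a set) \<Rightarrow> nat \<Rightarrow> nat set" where
  "initial_columns N blk l =
     {i\<in>{1..l}. \<forall>k. \<forall>j\<in>{1..l}. block_matrix N blk k j i = (if j = i then 1 else 0)}"

definition final_rows ::
  "(nat \<Rightarrow> 'a \<Rightarrow> 'a \<Rightarrow> real) \<Rightarrow> (nat \<Rightarrow> nat \<Rightarrow> 'a set) \<Rightarrow> nat \<Rightarrow> nat set" where
  "final_rows N blk l =
     {i\<in>{1..l}. \<forall>k. \<forall>j\<in>{1..l}. block_matrix N blk k i j = (if j = i then 1 else 0)}"

definition fixed_size_frobenius_normal_form ::
  "(nat \<Rightarrow> 'a::linorder set) \<Rightarrow> (nat \<Rightarrow> 'a \<Rightarrow> 'a \<Rightarrow> real) \<Rightarrow>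
   nat \<Rightarrow> (nat \<Rightarrow> nat \<Rightarrow> 'a set) \<Rightarrow> nat set \<Rightarrow> bool" where
  "fixed_size_frobenius_normal_form A N l blk P \<longleftrightarrow>
     bounded_size A \<and>
     frobenius_normal_form A N (\<lambda>k. l) blk P \<and>
     (\<exists>I F. extremal_choice (initial_columns N blk l) (final_rows N blk l) I F \<and>
        (\<forall>i\<in>I. \<forall>j\<in>{1..l} - I. i < j) \<and> (\<forall>i\<in>F. \<forall>j\<in>{1..l} - F. j < i)) \<and>
     (\<forall>k. card (A (Suc k)) = card (A k)) \<and>
     (\<forall>k. \<forall>i\<in>{1..l}. card (blk (Suc k) i) = card (blk k i)) \<and>
     (\<forall>k. \<forall>i\<in>{1..l}. blk k i \<noteq> {}) \<and>
     (\<forall>i\<in>{1..l}.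
        reduced (stream blk i) N \<and> primitive (stream blk i) N \<or>
        (\<forall>k. \<forall>x\<in>blk k i. \<forall>y\<in>blk (Suc k) i. N k x y = 0))"

text \<open>
  Two forms \<open>(e, blk, P)\<close> and \<open>(e', blk', P')\<close> of the same sequence are compared through the
  permutation of positions which preserves letters: from time \<open>K\<close> on it carries one matrix
  sequence to the other, and the primitive blocks of one form to those of the other. Hence
  it also carries pool letters to pool letters; the subdivision of these into
  individual pool blocks is not determined by the sequence.
\<close>

definition agree_up_to_permutation ::
  "(nat \<Rightarrow> 'a set) \<Rightarrow> (nat \<Rightarrow> 'a \<Rightarrow> 'a \<Rightarrow> real) \<Rightarrow>
   (nat \<Rightarrow> nat \<Rightarrow> 'a) \<Rightarrow> (nat \<Rightarrow> nat \<Rightarrow> nat set) \<Rightarrow> nat set \<Rightarrow>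
   (nat \<Rightarrow> nat \<Rightarrow> 'a) \<Rightarrow> (nat \<Rightarrow> nat \<Rightarrow> nat set) \<Rightarrow> nat set \<Rightarrow> nat \<Rightarrow> bool" where
  "agree_up_to_permutation A N e blk P e' blk' P' K \<longleftrightarrow>
     (\<exists>\<pi> \<sigma>. bij_betw \<sigma> P P' \<and>
        (\<forall>k\<ge>K. \<pi> k permutes positions A k \<and>
           (\<forall>x\<in>positions A k. e' k (\<pi> k x) = e k x) \<and>
           (\<forall>x\<in>positions A k. \<forall>y\<in>positions A (Suc k).
              reordered e' N k (\<pi> k x) (\<pi> (Suc k) y) = reordered e N k x y) \<and>
           (\<forall>i\<in>P. \<pi> k ` blk k i = blk' k (\<sigma> i))))"

end

theory Submission
  imports Defs "HOL-Library.Ramsey"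
begin

text \<open>
  Only the zero pattern of the matrices matters, and bounded alphabets leave finitely many patterns
  once the letters at each time are numbered. Colour a pair of times \<open>m < n\<close> by the pattern of
  the product from \<open>m\<close> to \<open>n\<close>. Ramsey's theorem gives times \<open>h 0 < h 1 < \<dots>\<close> between
  any two of which this pattern is one and the same relation \<open>R\<close> on a finite set \<open>L\<close>
  (\<open>ramsey_times\<close>). Composing two products shows that \<open>R\<close> is transitive, so the whole theory of
  normal forms reduces to a single finite transitive relation: its strongly connected classes
  containing a loop, on which \<open>R\<close> is total, are the primitive streams, and the points without a
  loop are the pool letters. A pool letter cannot return to itself, which is why pool blocks die
  out. Initial and final streams are the minimal and the maximal classes, because every point lies
  above and below some class with a loop (\<open>recurrent_predecessor\<close>).

  At the times \<open>h i\<close> a linear extension of \<open>R\<close> therefore triangularizes the products. It remains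
  to order the letters at the intermediate times. A letter \<open>z\<close> between \<open>h i\<close> and
  \<open>h (i + 1)\<close> belongs to a stream when some class sends a path to \<open>z\<close> and receives one from it;
  its label then has an even offset determined by the class. Otherwise it has an odd offset, just
  above the ranks from which \<open>z\<close> can be reached and above the initial classes. These labels never decrease along a
  path (\<open>label_mono\<close>), the streams are primitive (\<open>stream_eventually_positive\<close>), and the label
  of a pool letter cannot survive the next time \<open>h (i + 1)\<close> (\<open>pool_label_window\<close>). Before
  \<open>h 0\<close> each time receives a label of its own, so that the diagonal blocks there are virtual. Sorting the
  letters by their labels gives the normal form, and gathering along \<open>h\<close> gives the fixed-size one,
  since the gathered sequence has the constant pattern \<open>R\<close>.

  For uniqueness, compare two normal forms through the letters. The labels of the second form are
  nondecreasing along paths and bounded, so the largest one met by a primitive stream \<open>\<alpha>\<close> of the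
  first form is attained at some letter; primitivity of \<open>\<alpha>\<close> spreads it to all later letters of
  \<open>\<alpha>\<close>. Thus \<open>\<alpha>\<close> eventually lies in one block of the second form, which is not a pool block
  because paths inside \<open>\<alpha>\<close> do not die (\<open>stream_eventually_inside\<close>). Exchanging the two forms
  gives equality.
\<close>

section \<open>Vertex paths and products of matrices\<close>

definition leads ::
  "(nat \<Rightarrow> 'a set) \<Rightarrow> (nat \<Rightarrow> 'a \<Rightarrow> 'a \<Rightarrow> real) \<Rightarrow> nat \<Rightarrow> nat \<Rightarrow> 'a \<Rightarrow> 'a \<Rightarrow> bool" where
  "leads A N m n x y \<longleftrightarrow> m \<le> n \<and> (\<exists>p. vertex_path A N m n p \<and> p m = x \<and> p n = y)"

lemma leads_le: "leads A N m n x y \<Longrightarrow> m \<le> n"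
  by (simp add: leads_def)

lemma leads_source: "leads A N m n x y \<Longrightarrow> x \<in> A m"
  by (auto simp: leads_def vertex_path_def)

lemma leads_target: "leads A N m n x y \<Longrightarrow> y \<in> A n"
  by (auto simp: leads_def vertex_path_def)

lemma leads_same: "leads A N m m x y \<longleftrightarrow> x \<in> A m \<and> y = x"
  by (auto simp: leads_def vertex_path_def)

lemma leads_edge: "leads A N k (Suc k) x y \<longleftrightarrow> x \<in> A k \<and> y \<in> A (Suc k) \<and> 0 < N k x y"
proof
  assume "x \<in> A k \<and> y \<in> A (Suc k) \<and> 0 < N k x y"
  then show "leads A N k (Suc k) x y"
    unfolding leads_def vertex_path_def
    by (intro conjI exI[of _ "\<lambda>i. if i = k then x else y"]) (auto simp: le_Suc_eq)
qed (auto simp: leads_def vertex_path_def)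

lemma leads_trans:
  assumes "leads A N k m x y" "leads A N m n y z"
  shows "leads A N k n x z"
proof -
  obtain p where p: "vertex_path A N k m p" "p k = x" "p m = y"
    using assms by (auto simp: leads_def)
  obtain q where q: "vertex_path A N m n q" "q m = y" "q n = z"
    using assms by (auto simp: leads_def)
  have le: "k \<le> m" "m \<le> n" using assms by (auto simp: leads_def)
  let ?r = "\<lambda>i. if i \<le> m then p i else q i"
  have "?r i \<in> A i" if "i \<in> {k..n}" for i
    using that p q le by (auto simp: vertex_path_def)
  moreover have "0 < N i (?r i) (?r (Suc i))" if i: "i \<in> {k..<n}" for i
  proof -
    consider "Suc i \<le> m" | "m \<le> i" by linarith
    then show ?thesis
    proof cases
      case 2
      then have "?r i = q i" "?r (Suc i) = q (Suc i)" using p(3) q(2) by auto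
      then show ?thesis using 2 i q(1) by (auto simp: vertex_path_def)
    qed (use i p(1) in \<open>auto simp: vertex_path_def\<close>)
  qed
  moreover have "?r k = x" "?r n = z" using p q le by auto
  ultimately show ?thesis
    unfolding leads_def vertex_path_def using le
    by (intro conjI exI[of _ ?r]) auto
qed

lemma leads_split:
  assumes "leads A N k n x z" "k \<le> m" "m \<le> n"
  shows "\<exists>y. leads A N k m x y \<and> leads A N m n y z"
proof -
  obtain p where p: "vertex_path A N k n p" "p k = x" "p n = z"
    using assms by (auto simp: leads_def)
  have "leads A N k m x (p m)" "leads A N m n (p m) z"
    using p assms(2,3) unfolding leads_def vertex_path_def
    by (auto intro!: exI[of _ p])
  then show ?thesis by blast
qed

lemma leads_mono:
  assumes "leads S N m n x y" "\<And>i. S i \<subseteq> A i"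
  shows "leads A N m n x y"
  using assms unfolding leads_def vertex_path_def by blast

text \<open>
  Blocks are reached through this lemma: a path of the full sequence stays inside a stream as soon as
  every letter between its two ends belongs to the stream.
\<close>

lemma leads_restrict:
  assumes "leads A N m n x y"
    and "\<And>i z. leads A N m i x z \<Longrightarrow> leads A N i n z y \<Longrightarrow> z \<in> S i"
  shows "leads S N m n x y"
proof -
  obtain p where p: "vertex_path A N m n p" "p m = x" "p n = y" and le: "m \<le> n"
    using assms by (auto simp: leads_def)
  have "p i \<in> S i" if "i \<in> {m..n}" for i
  proof (rule assms(2))
    show "leads A N m i x (p i)" "leads A N i n (p i) y"
      using p that unfolding leads_def vertex_path_def by (auto intro!: exI[of _ p])
  qed
  then show ?thesis
    using p le unfolding leads_def vertex_path_def by blast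
qed

text \<open>
  Paths do not see the names of the letters. This carries statements between the original alphabets
  and the alphabets of positions produced by a reordering.
\<close>

lemma leads_relabel:
  assumes "\<And>i. e i ` S i = A i"
    and "\<And>i. inj_on (e i) (S i)"
    and "x \<in> S m" "y \<in> S n"
  shows "leads S (reordered e N) m n x y \<longleftrightarrow> leads A N m n (e m x) (e n y)"
proof
  assume "leads S (reordered e N) m n x y"
  then obtain p where "m \<le> n" "vertex_path S (reordered e N) m n p" "p m = x" "p n = y"
    by (auto simp: leads_def)
  then show "leads A N m n (e m x) (e n y)"
    unfolding leads_def vertex_path_def reordered_def using assms(1)
    by (intro conjI exI[of _ "\<lambda>i. e i (p i)"]) auto
next
  assume "leads A N m n (e m x) (e n y)"
  then obtain p where p: "m \<le> n" "vertex_path A N m n p" "p m = e m x" "p n = e n y"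
    by (auto simp: leads_def)
  let ?q = "\<lambda>i. inv_into (S i) (e i) (p i)"
  have q: "?q i \<in> S i \<and> e i (?q i) = p i" if "i \<in> {m..n}" for i
    using p(2) that assms(1)[of i] unfolding vertex_path_def
    by (metis f_inv_into_f inv_into_into)
  have "?q m = x" "?q n = y"
    using p(3,4) assms(2-4) by simp_all
  moreover have "vertex_path S (reordered e N) m n ?q"
    using p(2) q unfolding vertex_path_def reordered_def by auto
  ultimately show "leads S (reordered e N) m n x y"
    using p(1) unfolding leads_def by blast
qed

text \<open>
  Primitive blocks are defined through sequences that start at a later time \<open>s\<close>; this translates
  their paths back to the original time scale.
\<close>

lemma leads_shift:
  "leads (\<lambda>k. S (s + k)) (\<lambda>k. N (s + k)) m n x y \<longleftrightarrow> leads S N (s + m) (s + n) x y"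
proof
  assume "leads (\<lambda>k. S (s + k)) (\<lambda>k. N (s + k)) m n x y"
  then obtain p where p: "m \<le> n" "vertex_path (\<lambda>k. S (s + k)) (\<lambda>k. N (s + k)) m n p"
    "p m = x" "p n = y"
    by (auto simp: leads_def)
  have "p (i - s) \<in> S i" if "i \<in> {s + m..s + n}" for i
  proof -
    have "i - s \<in> {m..n}" "s + (i - s) = i" using that by auto
    then show ?thesis using p(2) unfolding vertex_path_def by metis
  qed
  moreover have "0 < N i (p (i - s)) (p (Suc i - s))" if "i \<in> {s + m..<s + n}" for i
  proof -
    have "i - s \<in> {m..<n}" "s + (i - s) = i" "Suc i - s = Suc (i - s)" using that by auto
    then show ?thesis using p(2) unfolding vertex_path_def by metis
  qed
  ultimately have "vertex_path S N (s + m) (s + n) (\<lambda>i. p (i - s))"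
    unfolding vertex_path_def by blast
  then show "leads S N (s + m) (s + n) x y"
    unfolding leads_def using p by (intro conjI exI[of _ "\<lambda>i. p (i - s)"]) auto
next
  assume "leads S N (s + m) (s + n) x y"
  then obtain p where "m \<le> n" "vertex_path S N (s + m) (s + n) p" "p (s + m) = x" "p (s + n) = y"
    by (auto simp: leads_def)
  then show "leads (\<lambda>k. S (s + k)) (\<lambda>k. N (s + k)) m n x y"
    unfolding leads_def vertex_path_def
    by (intro conjI exI[of _ "\<lambda>i. p (s + i)"]) auto
qed

lemma reduced_leads_forward:
  assumes "\<And>k x y. x \<in> A k \<Longrightarrow> y \<in> A (Suc k) \<Longrightarrow> 0 \<le> N k x y"
    and "\<And>k x. m \<le> k \<Longrightarrow> x \<in> A k \<Longrightarrow> \<exists>y\<in>A (Suc k). N k x y \<noteq> 0"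
    and "x \<in> A m" "m \<le> n"
  shows "\<exists>y. leads A N m n x y"
  using assms(4)
proof (induction n rule: dec_induct)
  case base
  then show ?case using assms(3) by (auto simp: leads_same)
next
  case (step n)
  then obtain y where y: "leads A N m n x y" by blast
  then obtain z where "z \<in> A (Suc n)" "N n y z \<noteq> 0"
    using assms(2)[OF step.hyps(1) leads_target[OF y]] by blast
  then have "leads A N n (Suc n) y z"
    using assms(1)[of y n z] leads_target[OF y] by (auto simp: leads_edge less_le)
  with y show ?case by (blast intro: leads_trans)
qed

lemma reduced_leads_backward:
  assumes "\<And>k x y. x \<in> A k \<Longrightarrow> y \<in> A (Suc k) \<Longrightarrow> 0 \<le> N k x y"
    and "\<And>k y. m \<le> k \<Longrightarrow> y \<in> A (Suc k) \<Longrightarrow> \<exists>x\<in>A k. N k x y \<noteq> 0"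
    and "y \<in> A n" "m \<le> n"
  shows "\<exists>x. leads A N m n x y"
  using assms(4,3)
proof (induction n arbitrary: y rule: dec_induct)
  case base
  then show ?case by (auto simp: leads_same)
next
  case (step n)
  then obtain x where "x \<in> A n" "N n x y \<noteq> 0"
    using assms(2)[OF step.hyps(1) step.prems] by blast
  then have "leads A N n (Suc n) x y"
    using assms(1)[of x n y] step.prems by (auto simp: leads_edge less_le)
  with step.IH[OF \<open>x \<in> A n\<close>] show ?case by (blast intro: leads_trans)
qed

text \<open>
  An entry of a product of nonnegative matrices is a sum over paths of nonnegative weights. Hence
  products enter the rest of the theory only through \<open>leads\<close>.
\<close>

lemma seq_prod_positive_iff_leads:
  assumes fin: "\<And>k. finite (S k)"
    and nonneg: "\<And>k x y. x \<in> S k \<Longrightarrow> y \<in> S (Suc k) \<Longrightarrow> 0 \<le> N k x y"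
    and "x \<in> S k" "y \<in> S (Suc n)" "k \<le> n"
  shows "0 \<le> seq_prod S N k n x y \<and> (0 < seq_prod S N k n x y \<longleftrightarrow> leads S N k (Suc n) x y)"
  using assms(5,4)
proof (induction n arbitrary: y rule: dec_induct)
  case base
  have "seq_prod S N k k = N k" by (cases k) auto
  then show ?case using nonneg[of x k y] base \<open>x \<in> S k\<close> by (simp add: leads_edge)
next
  case (step n)
  let ?f = "\<lambda>z. seq_prod S N k n x z * N (Suc n) z y"
  have eq: "seq_prod S N k (Suc n) x y = (\<Sum>z\<in>S (Suc n). ?f z)"
    using step.hyps(1) by simp
  have summand: "0 \<le> ?f z" if "z \<in> S (Suc n)" for z
    using step.IH[OF that] nonneg[OF that step.prems] by simp
  have "0 < (\<Sum>z\<in>S (Suc n). ?f z) \<longleftrightarrow> (\<exists>z\<in>S (Suc n). 0 < ?f z)"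
    using sum_nonneg_eq_0_iff[OF fin, of "Suc n" ?f] summand sum_nonneg[of "S (Suc n)" ?f]
    by (auto simp: less_le)
  also have "\<dots> \<longleftrightarrow> (\<exists>z\<in>S (Suc n). leads S N k (Suc n) x z \<and> leads S N (Suc n) (Suc (Suc n)) z y)"
  proof (intro bex_cong refl)
    fix z assume z: "z \<in> S (Suc n)"
    show "0 < ?f z \<longleftrightarrow> leads S N k (Suc n) x z \<and> leads S N (Suc n) (Suc (Suc n)) z y"
      using step.IH[OF z] nonneg[OF z step.prems] z step.prems
      by (auto simp: leads_edge zero_less_mult_iff)
  qed
  also have "\<dots> \<longleftrightarrow> leads S N k (Suc (Suc n)) x y"
    using step.hyps(1) leads_split[of S N k "Suc (Suc n)" x y "Suc n"]
    by (metis leads_target leads_trans le_SucI le_Suc_eq)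
  finally show ?case
    using eq summand by (auto intro: sum_nonneg)
qed

lemma seq_prod_zero_iff_not_leads:
  assumes "\<And>k. finite (S k)"
    and "\<And>k x y. x \<in> S k \<Longrightarrow> y \<in> S (Suc k) \<Longrightarrow> 0 \<le> N k x y"
    and "x \<in> S k" "y \<in> S (Suc n)" "k \<le> n"
  shows "seq_prod S N k n x y = 0 \<longleftrightarrow> \<not> leads S N k (Suc n) x y"
  using seq_prod_positive_iff_leads[of S N x k y n] assms by (metis less_le)

section \<open>Finite transitive relations\<close>

text \<open>
  These are the points of the strongly connected classes that contain a loop and have no predecessor
  outside; for the converse relation they are the classes without successor outside.
\<close>

definition initial_points :: "('b \<times> 'b) set \<Rightarrow> 'b set" where
  "initial_points R = {d. (d, d) \<in> R \<and> (\<forall>c. (c, d) \<in> R \<longrightarrow> (d, c) \<in> R)}"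

text \<open>
  Going backwards for ever in a finite set must repeat a point, and transitivity turns the repetition
  into a loop. In the proof the same is said by well-foundedness: without loops below \<open>d\<close> the
  relation would be well-founded there, yet every point has a predecessor.
\<close>

lemma recurrent_predecessor:
  assumes "finite R" "trans R" and "Domain R \<subseteq> Range R" and "d \<in> Range R"
  obtains r where "(r, r) \<in> R" "(r, d) \<in> R"
proof -
  have "\<exists>r. (r, r) \<in> R \<and> (r, d) \<in> R"
  proof (rule ccontr)
    assume none: "\<nexists>r. (r, r) \<in> R \<and> (r, d) \<in> R"
    define D where "D = {c. (c, d) \<in> R}"
    define S where "S = R \<inter> D \<times> D"
    have "trans S" using assms(2) unfolding S_def trans_def by blast
    moreover have "irrefl S" using none by (auto simp: S_def D_def irrefl_def)
    ultimately have "wf S"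
      using assms(1) by (intro finite_acyclic_wf) (auto simp: S_def acyclic_irrefl)
    moreover obtain c where "c \<in> D" using assms(4) by (auto simp: D_def)
    ultimately obtain m where m: "m \<in> D" "\<And>c. (c, m) \<in> S \<Longrightarrow> c \<notin> D"
      by (rule wfE_min) blast
    from m(1) have "m \<in> Range R" using assms(3) by (auto simp: D_def)
    then obtain c where c: "(c, m) \<in> R" by blast
    with m(1) have "c \<in> D" using transD[OF assms(2)] by (simp add: D_def)
    with c m(1) have "(c, m) \<in> S" by (simp add: S_def)
    with m(2) \<open>c \<in> D\<close> show False by blast
  qed
  with that show ?thesis by blast
qed

lemma div_mod_encoding:
  fixes a b a' b' W :: nat
  assumes "a * W + b = a' * W + b'" "b < W" "b' < W"
  shows "a = a' \<and> b = b'"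
proof -
  have "(a * W + b) div W = a" "(a' * W + b') div W = a'"
    using assms(2,3) by auto
  with assms(1) show ?thesis by auto
qed

text \<open>
  This serves to remove unused labels without changing the order of the others; a fixed-size form may
  not have empty blocks.
\<close>

lemma order_index:
  fixes V :: "nat set"
  assumes "finite V"
  obtains pos :: "nat \<Rightarrow> nat" where "pos ` V = {1..card V}"
    "\<And>u v. u \<in> V \<Longrightarrow> v \<in> V \<Longrightarrow> pos u < pos v \<longleftrightarrow> u < v"
proof -
  define pos where "pos v = card {u \<in> V. u \<le> v}" for v
  have less: "pos u < pos v" if "v \<in> V" "u < v" for u v
  proof -
    have "{w \<in> V. w \<le> u} \<subset> {w \<in> V. w \<le> v}"
    proof
      show "{w \<in> V. w \<le> u} \<subseteq> {w \<in> V. w \<le> v}" using that by auto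
      have "v \<in> {w \<in> V. w \<le> v}" "v \<notin> {w \<in> V. w \<le> u}" using that by simp_all
      then show "{w \<in> V. w \<le> u} \<noteq> {w \<in> V. w \<le> v}" by metis
    qed
    then show ?thesis unfolding pos_def using assms by (simp add: psubset_card_mono)
  qed
  have iff: "pos u < pos v \<longleftrightarrow> u < v" if "u \<in> V" "v \<in> V" for u v
    using less[OF that(2), of u] less[OF that(1), of v] by (metis less_asym' nat_neq_iff)
  have "inj_on pos V" using iff by (intro inj_onI) (metis less_irrefl nat_neq_iff)
  moreover have "pos ` V \<subseteq> {1..card V}"
  proof (rule image_subsetI)
    fix v assume v: "v \<in> V"
    have "pos v \<le> card V" unfolding pos_def using assms by (intro card_mono) auto
    moreover have "0 < pos v" unfolding pos_def using assms v by (auto simp: card_gt_0_iff)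
    ultimately show "pos v \<in> {1..card V}" by simp
  qed
  ultimately have "pos ` V = {1..card V}"
    by (intro card_subset_eq) (auto simp: card_image)
  then show ?thesis using iff by (rule that)
qed

text \<open>
  The rank of a point is built from three numbers in decreasing order of significance. The tier is
  \<open>0\<close> on minimal classes, \<open>2\<close> on maximal classes that are not minimal and \<open>1\<close> elsewhere; minimal
  classes have nothing below and maximal ones nothing above, so tiers respect \<open>R\<close>. The size of the
  down-set never decreases along \<open>R\<close> and grows from one class to a later one. The smallest element of the class separates the incomparable
  classes that are still tied. The thresholds \<open>T\<close> and \<open>U\<close> lie strictly between the tiers, which
  leaves room for the pool letters of intermediate times.
\<close>

lemma linear_extension_of_transitive_relation:
  fixes L :: "nat set" and R :: "(nat \<times> nat) set"
  assumes fin: "finite L" and R: "R \<subseteq> L \<times> L" and tr: "trans R"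
  obtains rank :: "nat \<Rightarrow> nat" and T U where
    "\<And>c d. (c, d) \<in> R \<Longrightarrow> rank c \<le> rank d"
    "\<And>c d. c \<in> L \<Longrightarrow> d \<in> L \<Longrightarrow> rank c = rank d \<Longrightarrow> c = d \<or> (c, d) \<in> R \<and> (d, c) \<in> R"
    "\<And>d. d \<in> L \<Longrightarrow> d \<in> initial_points R \<Longrightarrow> rank d < T"
    "\<And>d. d \<in> L \<Longrightarrow> d \<notin> initial_points R \<Longrightarrow> T < rank d"
    "\<And>d. d \<in> L \<Longrightarrow> d \<in> initial_points (R\<inverse>) - initial_points R \<Longrightarrow> U < rank d"
    "\<And>d. d \<in> L \<Longrightarrow> d \<notin> initial_points (R\<inverse>) - initial_points R \<Longrightarrow> rank d < U"
    "T \<le> U"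
proof -
  define down where "down d = {c \<in> L. (c, d) \<in> R \<or> c = d}" for d
  define cls where "cls d = {c \<in> L. c = d \<or> (c, d) \<in> R \<and> (d, c) \<in> R}" for d
  define M where "M = Max (insert 0 L)"
  define w where "w d = card (down d) * Suc M + Min (cls d)" for d
  \<comment> \<open>\<open>W\<close> exceeds all values of \<open>w\<close>, so tiers and weights can be read off the rank.\<close>
  define W where "W = (card L + 1) * Suc M"
  define tier :: "nat \<Rightarrow> nat" where "tier d = (if d \<in> initial_points R then 0
    else if d \<in> initial_points (R\<inverse>) then 2 else 1)" for d
  define rank where "rank d = tier d * W + w d" for d
  note trD = transD[OF tr]
  have fin': "finite (down d)" "finite (cls d)" for d
    using fin by (auto simp: down_def cls_def)
  have Min_cls: "Min (cls d) \<in> cls d" if "d \<in> L" for d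
    using that fin' by (intro Min_in) (auto simp: cls_def)
  have Min_le: "Min (cls d) < Suc M" if "d \<in> L" for d
  proof -
    have "Min (cls d) \<in> L" using Min_cls[OF that] by (auto simp: cls_def)
    then show ?thesis using fin by (auto simp: M_def less_Suc_eq_le)
  qed
  have down_pos: "0 < card (down d)" if "d \<in> L" for d
    using that fin' by (auto simp: down_def card_gt_0_iff)
  have w_pos: "0 < w d" if "d \<in> L" for d
    using down_pos[OF that] by (simp add: w_def)
  have w_less: "w d < W" if "d \<in> L" for d
  proof -
    have "card (down d) \<le> card L" using fin by (auto simp: down_def intro: card_mono)
    then have "card (down d) * Suc M \<le> card L * Suc M" by (rule mult_le_mono1)
    with Min_le[OF that] show ?thesis by (simp add: w_def W_def)
  qed
  have w_mono: "w c \<le> w d" if cd: "(c, d) \<in> R" for c d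
  proof -
    have L: "c \<in> L" "d \<in> L" using cd R by auto
    have sub: "down c \<subseteq> down d"
      using cd L unfolding down_def by (blast intro: trD)
    show ?thesis
    proof (cases "down c = down d")
      case True
      then have "c = d \<or> (d, c) \<in> R" using L by (auto simp: down_def)
      then have "cls c = cls d"
        using cd unfolding cls_def by (blast intro: trD)
      with True show ?thesis by (simp add: w_def)
    next
      case False
      with sub fin' have "card (down c) < card (down d)"
        by (intro psubset_card_mono) auto
      then have "Suc (card (down c)) * Suc M \<le> card (down d) * Suc M"
        by (intro mult_le_mono1) simp
      with Min_le[OF L(1)] show ?thesis by (simp add: w_def)
    qed
  qed
  have initial: "c \<in> initial_points R" if "(c, d) \<in> R" "d \<in> initial_points R" for c d
    using that unfolding initial_points_def by (blast intro: trD)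
  have final: "d \<in> initial_points (R\<inverse>)" if "(c, d) \<in> R" "c \<in> initial_points (R\<inverse>)" for c d
    using that unfolding initial_points_def by (blast intro: trD)
  have tier_mono: "tier c \<le> tier d" if "(c, d) \<in> R" for c d
    using initial[OF that] final[OF that] by (auto simp: tier_def)
  have "W > 0" by (simp add: W_def)
  show ?thesis
  proof (rule that[of rank W "2 * W"])
    show "rank c \<le> rank d" if "(c, d) \<in> R" for c d
      using w_mono[OF that] tier_mono[OF that] by (simp add: rank_def add_mono)
    show "c = d \<or> (c, d) \<in> R \<and> (d, c) \<in> R" if "c \<in> L" "d \<in> L" "rank c = rank d" for c d
    proof -
      have "w c = w d"
        using div_mod_encoding[OF that(3)[unfolded rank_def] w_less w_less] that by blast
      then have "Min (cls c) = Min (cls d)"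
        unfolding w_def using div_mod_encoding[OF _ Min_le Min_le] that by blast
      then obtain m where "m \<in> cls c" "m \<in> cls d" using Min_cls[OF \<open>c \<in> L\<close>] Min_cls[OF \<open>d \<in> L\<close>] by auto
      then show ?thesis unfolding cls_def by (blast intro: trD)
    qed
  next
    show "rank d < 2 * W" if "d \<in> L" "d \<notin> initial_points (R\<inverse>) - initial_points R" for d
      using w_less[OF that(1)] that(2) by (auto simp: rank_def tier_def)
  qed (use w_less w_pos in \<open>auto simp: rank_def tier_def\<close>)
qed

section \<open>A gathering with constant zero pattern\<close>

text \<open>
  The letters at time \<open>k\<close> are numbered by \<open>g k\<close>, so that the patterns at different times can be
  compared. One colour for all pairs also forces equal alphabets at the selected times: the domain of
  the pattern of the product from \<open>h i\<close> to \<open>h (i + 1)\<close> is the whole alphabet at time \<open>h i\<close>,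
  since no row of a product of reduced matrices vanishes.
\<close>

lemma ramsey_times:
  assumes "matrix_sequence A N" "bounded_size A" "reduced A N"
  obtains h :: "nat \<Rightarrow> nat" and c :: "nat \<Rightarrow> 'a \<Rightarrow> nat" and L R where
    "strict_mono h" "finite L" "R \<subseteq> L \<times> L" "trans R"
    "\<And>i. bij_betw (c i) (A (h i)) L"
    "\<And>i j x y. i < j \<Longrightarrow> x \<in> A (h i) \<Longrightarrow> y \<in> A (h j) \<Longrightarrow>
       leads A N (h i) (h j) x y \<longleftrightarrow> (c i x, c j y) \<in> R"
proof -
  obtain b where b: "\<And>k. finite (A k)" "\<And>k. card (A k) \<le> b"
    using assms(2) by (auto simp: bounded_size_def)
  have nonneg: "0 \<le> N k x y" if "x \<in> A k" "y \<in> A (Suc k)" for k x y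
    using assms(1) that by (auto simp: matrix_sequence_def)
  have "\<exists>g. bij_betw g (A k) {0..<card (A k)}" for k
    using b(1) by (rule ex_bij_betw_finite_nat)
  then obtain g where g: "\<And>k. bij_betw (g k) (A k) {0..<card (A k)}" by metis
  have g_img: "g k ` A k = {0..<card (A k)}" for k using g by (simp add: bij_betw_def)
  have g_less: "g k x < b" if "x \<in> A k" for k x
    using that g_img[of k] b(2)[of k] by (metis atLeastLessThan_iff imageI order_less_le_trans)
  define pat where
    "pat m n = {(g m x, g n y) | x y. x \<in> A m \<and> y \<in> A n \<and> leads A N m n x y}" for m n
  define C where "C = Pow ({..<b} \<times> {..<b})"
  have pat_C: "pat m n \<in> C" for m n
    using g_less by (auto simp: pat_def C_def)
  have "finite C" by (simp add: C_def)
  then obtain code where code: "bij_betw code C {0..<card C}"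
    using ex_bij_betw_finite_nat by blast
  \<comment> \<open>Ramsey's theorem colours unordered pairs; the smaller time starts the product.\<close>
  define f where "f X = code (pat (Min X) (Max X))" for X
  have "f X < card C" for X
    using code pat_C by (auto simp: f_def bij_betw_def)
  then obtain Y t where Y: "infinite Y" "\<And>x y. x \<in> Y \<Longrightarrow> y \<in> Y \<Longrightarrow> x \<noteq> y \<Longrightarrow> f {x, y} = t"
    using Ramsey2[of "UNIV :: nat set" f "card C"] by auto
  define h where "h = enumerate Y"
  have h: "strict_mono h" unfolding h_def using Y(1) by (rule strict_mono_enumerate)
  have hY: "h i \<in> Y" for i unfolding h_def using Y(1) by (rule enumerate_in_set)
  have lt: "h i < h j" if "i < j" for i j using h that by (simp add: strict_mono_less)
  define R where "R = pat (h 0) (h 1)"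
  have pat_R: "pat (h i) (h j) = R" if "i < j" for i j
  proof -
    have "f {h i, h j} = t" "f {h 0, h 1} = t"
      using Y(2)[OF hY hY] lt[OF that] lt[of 0 1] by auto
    then have "code (pat (h i) (h j)) = code (pat (h 0) (h 1))"
      using lt[OF that] lt[of 0 1] by (simp add: f_def)
    then show ?thesis
      using code pat_C unfolding R_def bij_betw_def by (meson inj_onD)
  qed
  have dom: "g (h i) ` A (h i) = Domain R" for i
  proof -
    have "\<exists>y. leads A N (h i) (h (Suc i)) x y" if "x \<in> A (h i)" for x
      using assms(3) that lt[of i "Suc i"]
      by (intro reduced_leads_forward nonneg) (auto simp: reduced_def)
    then have "g (h i) ` A (h i) = Domain (pat (h i) (h (Suc i)))"
      by (auto simp: pat_def Domain_iff) (metis leads_target)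
    with pat_R[of i "Suc i"] show ?thesis by simp
  qed
  have inj: "inj_on (g k) (A k)" for k using g by (simp add: bij_betw_def)
  have bij: "bij_betw (g (h i)) (A (h i)) (Domain R)" for i
    using dom inj by (simp add: bij_betw_def)
  have leads_iff: "leads A N (h i) (h j) x y \<longleftrightarrow> (g (h i) x, g (h j) y) \<in> R"
    if "i < j" "x \<in> A (h i)" "y \<in> A (h j)" for i j x y
    using that inj unfolding pat_R[OF that(1), symmetric] pat_def
    by (auto dest: inj_onD)
  have R_sub: "R \<subseteq> Domain R \<times> Domain R"
  proof -
    have "R \<subseteq> g (h 0) ` A (h 0) \<times> g (h 1) ` A (h 1)" by (auto simp: R_def pat_def)
    then show ?thesis by (simp add: dom)
  qed
  have "trans R"
  proof (rule transI)
    fix d1 d2 d3 assume d: "(d1, d2) \<in> R" "(d2, d3) \<in> R"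
    have surj: "\<exists>x\<in>A (h i). g (h i) x = d" if "d \<in> Domain R" for d i
    proof -
      have "d \<in> g (h i) ` A (h i)" using that by (simp only: dom)
      then show ?thesis by blast
    qed
    have "d1 \<in> Domain R" "d2 \<in> Domain R" "d3 \<in> Domain R" using R_sub d by auto
    then obtain x y z where xyz: "x \<in> A (h 0)" "g (h 0) x = d1" "y \<in> A (h 1)" "g (h 1) y = d2"
      "z \<in> A (h 2)" "g (h 2) z = d3"
      using surj by meson
    then have "leads A N (h 0) (h 1) x y" "leads A N (h 1) (h 2) y z"
      using leads_iff[of 0 1 x y] leads_iff[of 1 2 y z] d by simp_all
    then have "leads A N (h 0) (h 2) x z" by (rule leads_trans)
    then show "(d1, d3) \<in> R" using leads_iff[of 0 2 x z] xyz by simp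
  qed
  moreover have "finite (Domain R)" using dom[of 0] b(1) by (metis finite_imageI)
  ultimately show ?thesis by (intro that[OF h _ R_sub _ bij leads_iff])
qed

section \<open>Labelling the letters\<close>

text \<open>
  The data from which the normal form is built: the times \<open>h\<close> of constant pattern, the numberings
  \<open>c i\<close> of the letters at time \<open>h i\<close> by \<open>L\<close>, the pattern \<open>R\<close>, and a ranking of \<open>L\<close> with
  the initial classes below \<open>T\<close> and the other final classes above \<open>U\<close>.
\<close>

locale ramsey_frame =
  fixes A :: "nat \<Rightarrow> 'a set" and N :: "nat \<Rightarrow> 'a \<Rightarrow> 'a \<Rightarrow> real"
    and h :: "nat \<Rightarrow> nat" and c :: "nat \<Rightarrow> 'a \<Rightarrow> nat"
    and L :: "nat set" and R :: "(nat \<times> nat) set"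
    and rank :: "nat \<Rightarrow> nat" and T U :: nat
  assumes matrix: "matrix_sequence A N" and red: "reduced A N"
    and h_mono: "strict_mono h"
    and finite_L: "finite L" and R_sub: "R \<subseteq> L \<times> L" and trans_rel_R: "trans R"
    and c_bij: "\<And>i. bij_betw (c i) (A (h i)) L"
    and leads_iff: "\<And>i j x y. i < j \<Longrightarrow> x \<in> A (h i) \<Longrightarrow> y \<in> A (h j) \<Longrightarrow>
      leads A N (h i) (h j) x y \<longleftrightarrow> (c i x, c j y) \<in> R"
    and rank_mono: "\<And>d e. (d, e) \<in> R \<Longrightarrow> rank d \<le> rank e"
    and rank_eq: "\<And>d e. d \<in> L \<Longrightarrow> e \<in> L \<Longrightarrow> rank d = rank e \<Longrightarrow>
      d = e \<or> (d, e) \<in> R \<and> (e, d) \<in> R"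
    and rank_initial: "\<And>d. d \<in> L \<Longrightarrow> d \<in> initial_points R \<Longrightarrow> rank d < T"
    and rank_not_initial: "\<And>d. d \<in> L \<Longrightarrow> d \<notin> initial_points R \<Longrightarrow> T < rank d"
    and rank_final: "\<And>d. d \<in> L \<Longrightarrow>
      d \<in> initial_points (R\<inverse>) - initial_points R \<Longrightarrow> U < rank d"
    and rank_not_final: "\<And>d. d \<in> L \<Longrightarrow>
      d \<notin> initial_points (R\<inverse>) - initial_points R \<Longrightarrow> rank d < U"
    and T_le_U: "T \<le> U"
begin

definition window :: "nat \<Rightarrow> nat" where
  "window k = Max {i. h i \<le> k}"

text \<open>
  The points of \<open>L\<close> which reach a letter from the start of its window, and those which it reaches at
  the end of that window. A letter at a time \<open>h i\<close> is its own unique predecessor (\<open>pre_h\<close>).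
\<close>

definition pre :: "nat \<Rightarrow> 'a \<Rightarrow> nat set" where
  "pre k z = {c (window k) x | x. leads A N (h (window k)) k x z}"

definition post :: "nat \<Rightarrow> 'a \<Rightarrow> nat set" where
  "post k z = {c (Suc (window k)) y | y. leads A N k (h (Suc (window k))) z y}"

text \<open>
  The letter \<open>z\<close> belongs to the stream of a class exactly when it lies on a path between two points of
  that class. The core consists of the points of that class among the predecessors; it is empty for
  pool letters.
\<close>

definition core :: "nat \<Rightarrow> 'a \<Rightarrow> nat set" where
  "core k z = {d \<in> pre k z. \<exists>e\<in>post k z. (e, d) \<in> R}"

text \<open>
  Even offsets are reserved for streams and odd ones for pools. A pool letter is placed just after
  the highest predecessor, but at least after the initial classes, since it can lead to none of
  them. The label \<open>Suc k\<close> before \<open>h 0\<close> occurs at the single time \<open>k\<close>, so that its diagonal blocks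
  are virtual, and it stays below all labels used from \<open>h 0\<close> on.
\<close>

definition label :: "nat \<Rightarrow> 'a \<Rightarrow> nat" where
  "label k z =
     (if k < h 0 then Suc k
      else Suc (h 0 + (if core k z \<noteq> {} then 2 * Max (rank ` pre k z)
                       else 2 * max T (Max (rank ` pre k z)) + 1)))"

text \<open>
  This is the label of a letter at a time \<open>h i\<close>, expressed through its number in \<open>L\<close>
  (\<open>label_h\<close>).
\<close>

definition point_label :: "nat \<Rightarrow> nat" where
  "point_label d = Suc (h 0 + 2 * rank d + (if (d, d) \<in> R then 0 else 1))"

lemma nonneg: "x \<in> A k \<Longrightarrow> y \<in> A (Suc k) \<Longrightarrow> 0 \<le> N k x y"
  using matrix by (auto simp: matrix_sequence_def)

lemma finite_A: "finite (A k)"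
  using matrix by (auto simp: matrix_sequence_def)

lemma h_less: "i < j \<Longrightarrow> h i < h j" and h_le: "i \<le> j \<Longrightarrow> h i \<le> h j"
  using h_mono by (auto simp: strict_mono_less strict_mono_less_eq)

lemma h_ge: "i \<le> h i"
  using h_mono by (rule strict_mono_imp_increasing)

lemma forward: "x \<in> A m \<Longrightarrow> m \<le> n \<Longrightarrow> \<exists>y. leads A N m n x y"
  using red by (intro reduced_leads_forward nonneg) (auto simp: reduced_def)

lemma backward: "y \<in> A n \<Longrightarrow> m \<le> n \<Longrightarrow> \<exists>x. leads A N m n x y"
  using red by (intro reduced_leads_backward nonneg) (auto simp: reduced_def)

lemma c_in: "x \<in> A (h i) \<Longrightarrow> c i x \<in> L"
  using c_bij by (auto simp: bij_betw_def)

lemma c_surj: "d \<in> L \<Longrightarrow> \<exists>x\<in>A (h i). c i x = d"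
  using c_bij[of i] unfolding bij_betw_def by blast

lemma leads_R: "leads A N (h i) (h j) x y \<Longrightarrow> i < j \<Longrightarrow> (c i x, c j y) \<in> R"
  using leads_iff leads_source leads_target by metis

lemma leads_R_refl: "leads A N (h i) (h j) x y \<Longrightarrow> i \<le> j \<Longrightarrow> c i x = c j y \<or> (c i x, c j y) \<in> R"
  using leads_R by (cases "i = j") (auto simp: leads_same)

lemma trans_R: "(d, e) \<in> R \<Longrightarrow> (e, f) \<in> R \<Longrightarrow> (d, f) \<in> R"
  using trans_rel_R by (rule transD)

lemma R_succ: "d \<in> L \<Longrightarrow> \<exists>e. (d, e) \<in> R"
  using c_surj[of d 0] forward[OF _ h_le[of 0 1]] leads_R[of 0 1] by fastforce

lemma R_pred: "d \<in> L \<Longrightarrow> \<exists>e. (e, d) \<in> R"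
  using c_surj[of d 1] backward[OF _ h_le[of 0 1]] leads_R[of 0 1] by fastforce

lemma R_in: "(d, e) \<in> R \<Longrightarrow> d \<in> L" "(d, e) \<in> R \<Longrightarrow> e \<in> L"
  using R_sub by auto

lemma rank_eq_R: "(d, e) \<in> R \<Longrightarrow> rank d = rank e \<Longrightarrow> (e, d) \<in> R"
  using rank_eq R_in by metis

lemma class_R: "(d, d) \<in> R \<Longrightarrow> e \<in> L \<Longrightarrow> rank e = rank d \<Longrightarrow> (d, e) \<in> R \<and> (e, d) \<in> R"
  using rank_eq[of e d] R_in by blast

lemma rank_both: "(d, e) \<in> R \<Longrightarrow> (e, d) \<in> R \<Longrightarrow> rank d = rank e"
  using rank_mono by (metis antisym)

lemma window_unique: "h i \<le> k \<Longrightarrow> k < h (Suc i) \<Longrightarrow> window k = i"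
proof -
  assume *: "h i \<le> k" "k < h (Suc i)"
  have le: "j \<le> i" if "h j \<le> k" for j
    using that * h_le[of "Suc i" j] by (cases "j \<le> i") auto
  then have "finite {j. h j \<le> k}" by (intro finite_subset[OF _ finite_atMost[of i]]) blast
  then show ?thesis unfolding window_def using *(1) le by (intro Max_eqI) simp_all
qed

lemma window:
  assumes "h 0 \<le> k"
  shows "h (window k) \<le> k" "k < h (Suc (window k))"
proof -
  have fin: "finite {i. h i \<le> k}"
    using order_trans[OF h_ge] by (intro finite_subset[OF _ finite_atMost[of k]]) blast
  with assms have "window k \<in> {i. h i \<le> k}" unfolding window_def by (intro Max_in) auto
  then show "h (window k) \<le> k" by simp
  have "Suc (window k) \<notin> {i. h i \<le> k}"
    using Max_ge[OF fin, of "Suc (window k)"] unfolding window_def by auto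
  then show "k < h (Suc (window k))" by simp
qed

lemma window_h: "window (h i) = i"
  using h_less[of i "Suc i"] by (intro window_unique) auto

lemma window_ge: "h 0 \<le> k \<Longrightarrow> h i \<le> k \<Longrightarrow> i \<le> window k"
  using window(2)[of k] h_le[of "Suc (window k)" i] by (cases "i \<le> window k") auto

lemma window_less: "h 0 \<le> k \<Longrightarrow> k < h i \<Longrightarrow> window k < i"
  using window(1)[of k] h_le[of i "window k"] by (cases "window k < i") auto

lemma window_mono: "h 0 \<le> k \<Longrightarrow> k \<le> n \<Longrightarrow> window k \<le> window n"
  using window(1)[of k] by (intro window_ge) auto

lemma pre_in_L: "pre k z \<subseteq> L"
  by (auto simp: pre_def intro: c_in leads_source)

lemma finite_pre: "finite (pre k z)"
  using pre_in_L finite_L by (rule finite_subset)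

lemma pre_nonempty: "h 0 \<le> k \<Longrightarrow> z \<in> A k \<Longrightarrow> pre k z \<noteq> {}"
  using backward[OF _ window(1)] by (auto simp: pre_def)

lemma post_nonempty: "h 0 \<le> k \<Longrightarrow> z \<in> A k \<Longrightarrow> post k z \<noteq> {}"
  using forward[OF _ less_imp_le[OF window(2)]] by (auto simp: post_def)

lemma Max_rank_pre: "h 0 \<le> k \<Longrightarrow> z \<in> A k \<Longrightarrow> \<exists>d\<in>pre k z. rank d = Max (rank ` pre k z)"
proof -
  assume "h 0 \<le> k" "z \<in> A k"
  then have "Max (rank ` pre k z) \<in> rank ` pre k z"
    using finite_pre pre_nonempty by (intro Max_in) auto
  then show ?thesis by force
qed

lemma pre_leads_post:
  assumes "h 0 \<le> k" "leads A N k n z w" "d \<in> pre k z" "e \<in> post n w"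
  shows "(d, e) \<in> R"
proof -
  obtain x y where "d = c (window k) x" "leads A N (h (window k)) k x z"
    "e = c (Suc (window n)) y" "leads A N n (h (Suc (window n))) w y"
    using assms by (auto simp: pre_def post_def)
  moreover have "window k < Suc (window n)"
    using window_mono[OF assms(1) leads_le[OF assms(2)]] by simp
  ultimately show ?thesis using assms(2) leads_trans leads_R by metis
qed

lemma pre_post: "h 0 \<le> k \<Longrightarrow> z \<in> A k \<Longrightarrow> d \<in> pre k z \<Longrightarrow> e \<in> post k z \<Longrightarrow> (d, e) \<in> R"
  by (rule pre_leads_post[of k k z z]) (auto simp: leads_same)

lemma core_recurrent: "h 0 \<le> k \<Longrightarrow> z \<in> A k \<Longrightarrow> d \<in> core k z \<Longrightarrow> (d, d) \<in> R"
  using pre_post trans_R unfolding core_def by blast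

lemma rank_core:
  assumes "h 0 \<le> k" "z \<in> A k" "d \<in> core k z"
  shows "Max (rank ` pre k z) = rank d"
proof (rule Max_eqI)
  show "rank d \<in> rank ` pre k z" using assms by (auto simp: core_def)
  fix r assume "r \<in> rank ` pre k z"
  then obtain d' where d': "d' \<in> pre k z" "r = rank d'" by blast
  obtain e where "e \<in> post k z" "(e, d) \<in> R" using assms(3) by (auto simp: core_def)
  with pre_post[OF assms(1,2) d'(1)] have "(d', d) \<in> R" using trans_R by blast
  with d'(2) show "r \<le> rank d" using rank_mono by simp
qed (simp add: finite_pre)

lemma label_core:
  "h 0 \<le> k \<Longrightarrow> z \<in> A k \<Longrightarrow> d \<in> core k z \<Longrightarrow> label k z = Suc (h 0 + 2 * rank d)"
  using rank_core[of k z d] unfolding label_def by auto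

lemma label_no_core:
  "h 0 \<le> k \<Longrightarrow> core k z = {} \<Longrightarrow>
     label k z = Suc (h 0 + (2 * max T (Max (rank ` pre k z)) + 1))"
  unfolding label_def by auto

text \<open>
  If \<open>z\<close> leads to a stream letter, the predecessors of \<open>z\<close> lie below the class of the stream. The
  second conclusion is what makes labels strictly increase when a path enters a stream: if in
  addition that class led back to a predecessor of \<open>z\<close>, then \<open>z\<close> would lie on the stream.
\<close>

lemma core_forward:
  assumes "h 0 \<le> k" "leads A N k n z w" "d \<in> core n w"
  shows "\<forall>d'\<in>pre k z. (d', d) \<in> R" and "\<exists>e\<in>post k z. (e, d) \<in> R"
proof -
  have w: "w \<in> A n" "h 0 \<le> n" using assms leads_target leads_le by fastforce+
  obtain e y where e: "e \<in> post n w" "(e, d) \<in> R" "e = c (Suc (window n)) y"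
    "leads A N n (h (Suc (window n))) w y"
    using assms(3) by (auto simp: core_def post_def)
  show "\<forall>d'\<in>pre k z. (d', d) \<in> R"
    using pre_leads_post[OF assms(1,2) _ e(1)] e(2) trans_R by blast
  have zy: "leads A N k (h (Suc (window n))) z y" using assms(2) e(4) by (rule leads_trans)
  have "window k \<le> window n"
    using assms(1) leads_le[OF assms(2)] by (rule window_mono)
  then obtain v where v: "leads A N k (h (Suc (window k))) z v"
    "leads A N (h (Suc (window k))) (h (Suc (window n))) v y"
    using leads_split[OF zy less_imp_le[OF window(2)[OF assms(1)]] h_le] by auto
  then have "c (Suc (window k)) v = e \<or> (c (Suc (window k)) v, e) \<in> R"
    using leads_R_refl[OF v(2)] \<open>window k \<le> window n\<close> e(3) by simp
  then have "(c (Suc (window k)) v, d) \<in> R" using e(2) trans_R by blast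
  with v(1) show "\<exists>e\<in>post k z. (e, d) \<in> R" by (auto simp: post_def)
qed

lemma pre_forward:
  assumes "h 0 \<le> k" "leads A N k n z w" "d \<in> pre k z"
  shows "\<exists>d'\<in>pre n w. rank d \<le> rank d'"
proof -
  obtain x where x: "d = c (window k) x" "leads A N (h (window k)) k x z"
    using assms(3) by (auto simp: pre_def)
  have n: "h 0 \<le> n" using assms leads_le by fastforce
  have le: "window k \<le> window n" using assms(1) leads_le[OF assms(2)] by (rule window_mono)
  have "leads A N (h (window k)) n x w" using x(2) assms(2) by (rule leads_trans)
  from leads_split[OF this h_le[OF le] window(1)[OF n]]
  obtain v where v: "leads A N (h (window k)) (h (window n)) x v" "leads A N (h (window n)) n v w"
    by blast
  then have "rank d \<le> rank (c (window n) v)"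
    using leads_R_refl[OF v(1) le] x(1) rank_mono by auto
  with v(2) show ?thesis by (auto simp: pre_def)
qed

lemma Max_rank_forward:
  assumes "h 0 \<le> k" "leads A N k n z w"
  shows "Max (rank ` pre k z) \<le> Max (rank ` pre n w)"
proof -
  obtain d where "d \<in> pre k z" "Max (rank ` pre k z) = rank d"
    using Max_rank_pre[OF assms(1) leads_source[OF assms(2)]] by metis
  then obtain d' where "d' \<in> pre n w" "Max (rank ` pre k z) \<le> rank d'"
    using pre_forward[OF assms] by auto
  then show ?thesis using finite_pre by (meson Max_ge finite_imageI imageI order_trans)
qed

text \<open>
  Only the step from a pool into a stream needs more than monotonicity of the largest predecessor
  rank, because it passes from an odd offset to an even one. There the rank strictly increases, and the
  stream is not initial, so that its rank also exceeds the threshold \<open>T\<close>.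
\<close>

lemma label_mono_late:
  assumes "h 0 \<le> k" "leads A N k n z w"
  shows "label k z \<le> label n w"
proof -
  have z: "z \<in> A k" and w: "w \<in> A n" and n: "h 0 \<le> n"
    using assms leads_source leads_target leads_le by fastforce+
  note max = Max_rank_forward[OF assms]
  show ?thesis
  proof (cases "core k z = {} \<and> core n w \<noteq> {}")
    case True
    then obtain d where d: "d \<in> core n w" by blast
    obtain e where e: "e \<in> post k z" "(e, d) \<in> R" using core_forward(2)[OF assms d] by blast
    have pre_R: "(d', d) \<in> R" and not_back: "(d, d') \<notin> R" if d': "d' \<in> pre k z" for d'
      using core_forward(1)[OF assms d] d' True e trans_R unfolding core_def by blast+
    obtain d0 where d0: "d0 \<in> pre k z" "Max (rank ` pre k z) = rank d0"
      using Max_rank_pre[OF assms(1) z] by metis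
    have "rank d0 < rank d"
      using rank_mono[OF pre_R] rank_eq_R[OF pre_R] not_back d0(1) by (metis le_neq_implies_less)
    moreover have "T < rank d"
      using rank_not_initial[of d] pre_R not_back d0(1) R_in by (force simp: initial_points_def)
    ultimately show ?thesis
      using label_core[OF n w d] label_no_core[OF assms(1), of z] True d0(2) by simp
  next
    case False
    then show ?thesis using max assms(1) n by (auto simp: label_def)
  qed
qed

lemma label_mono:
  assumes "leads A N k n z w"
  shows "label k z \<le> label n w"
  using label_mono_late[OF _ assms] leads_le[OF assms] by (cases "h 0 \<le> k") (auto simp: label_def)

lemma label_bounds: "label k z \<in> {1..Suc (h 0 + (2 * max T (Max (rank ` L)) + 1))}" if "z \<in> A k"
proof (cases "h 0 \<le> k")
  case True
  then have "Max (rank ` pre k z) \<le> Max (rank ` L)"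
    using pre_in_L pre_nonempty[OF True that] finite_L by (intro Max_mono image_mono) auto
  with True show ?thesis by (auto simp: label_def)
qed (auto simp: label_def)

lemma pre_h: "x \<in> A (h i) \<Longrightarrow> pre (h i) x = {c i x}"
  by (auto simp: pre_def window_h leads_same)

lemma core_h: "x \<in> A (h i) \<Longrightarrow> core (h i) x = (if (c i x, c i x) \<in> R then {c i x} else {})"
proof -
  assume x: "x \<in> A (h i)"
  have "(\<exists>e\<in>post (h i) x. (e, c i x) \<in> R) \<longleftrightarrow> (c i x, c i x) \<in> R"
  proof
    assume "(c i x, c i x) \<in> R"
    moreover obtain y where "y \<in> A (h (Suc i))" "c (Suc i) y = c i x"
      using c_surj[OF c_in[OF x]] by blast
    ultimately have "c i x \<in> post (h i) x"
      unfolding post_def window_h using leads_iff[of i "Suc i" x y] x by force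
    with \<open>(c i x, c i x) \<in> R\<close> show "\<exists>e\<in>post (h i) x. (e, c i x) \<in> R" by blast
  next
    assume "\<exists>e\<in>post (h i) x. (e, c i x) \<in> R"
    then show "(c i x, c i x) \<in> R"
      using pre_post[of "h i" x "c i x"] pre_h[OF x] x h_le[of 0 i] trans_R by blast
  qed
  then show ?thesis unfolding core_def pre_h[OF x] by auto
qed

lemma label_h: "x \<in> A (h i) \<Longrightarrow> label (h i) x = point_label (c i x)"
proof -
  assume x: "x \<in> A (h i)"
  have "\<not> h i < h 0" using h_le[of 0 i] by simp
  \<comment> \<open>A point without a loop is not initial, so the threshold has no effect at the times \<open>h i\<close>.\<close>
  moreover have "max T (rank (c i x)) = rank (c i x)" if "(c i x, c i x) \<notin> R"
    using that rank_not_initial[OF c_in[OF x]] by (auto simp: initial_points_def)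
  ultimately show ?thesis
    unfolding label_def point_label_def core_h[OF x] pre_h[OF x] by simp
qed

lemma recurrent_label_iff:
  assumes "h 0 \<le> k" "z \<in> A k" "(d, d) \<in> R"
  shows "label k z = point_label d \<longleftrightarrow> (\<exists>d'\<in>core k z. rank d' = rank d)"
proof
  assume "\<exists>d'\<in>core k z. rank d' = rank d"
  then show "label k z = point_label d"
    using label_core[OF assms(1,2)] assms(3) by (force simp: point_label_def)
next
  assume *: "label k z = point_label d"
  have "core k z \<noteq> {}"
  proof
    assume "core k z = {}"
    then have "2 * max T (Max (rank ` pre k z)) + 1 = 2 * rank d"
      using label_no_core[OF assms(1)] * assms(3) by (auto simp: point_label_def)
    then show False by presburger
  qed
  then obtain d' where "d' \<in> core k z" by blast
  with * show "\<exists>d'\<in>core k z. rank d' = rank d"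
    using label_core[OF assms(1,2)] assms(3) by (intro bexI[of _ d']) (auto simp: point_label_def)
qed

text \<open>
  The two ends may be many windows apart. Cutting the path at the ends of the window of \<open>z\<close> produces
  two points that lie between points of the class of \<open>d\<close>, hence in that class.
\<close>

lemma sandwich:
  assumes d: "(d, d) \<in> R" and ab: "a < b"
    and x: "leads A N (h a) k x z" "rank (c a x) = rank d"
    and y: "leads A N k (h b) z y" "rank (c b y) = rank d"
  shows "label k z = point_label d"
proof -
  have main: "label k z = point_label d"
    if kb: "k < h b" and y: "leads A N k (h b) z y" "rank (c b y) = rank d" for b y
  proof -
    define i where "i = window k"
    have k: "h 0 \<le> k" using leads_le[OF x(1)] h_le[of 0 a] by simp
    have z: "z \<in> A k" using x(1) by (rule leads_target)
    have i: "a \<le> i" "Suc i \<le> b"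
      unfolding i_def using window_ge[OF k leads_le[OF x(1)]] window_less[OF k kb] by auto
    obtain x' where x': "leads A N (h a) (h i) x x'" "leads A N (h i) k x' z"
      using leads_split[OF x(1) h_le[OF i(1)]] window(1)[OF k] by (metis i_def)
    obtain y' where y': "leads A N k (h (Suc i)) z y'" "leads A N (h (Suc i)) (h b) y' y"
      using leads_split[OF y(1) _ h_le[OF i(2)]] window(2)[OF k] by (metis i_def less_imp_le)
    let ?d = "c i x'" and ?e = "c (Suc i) y'"
    have cx: "c a x \<in> L" "c b y \<in> L" using x(1) y(1) leads_source leads_target c_in by metis+
    have "(d, c a x) \<in> R" "(c b y, d) \<in> R" using class_R[OF d] cx x(2) y(2) by blast+
    moreover have "c a x = ?d \<or> (c a x, ?d) \<in> R" "?e = c b y \<or> (?e, c b y) \<in> R"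
      using leads_R_refl[OF x'(1) i(1)] leads_R_refl[OF y'(2) i(2)] by auto
    ultimately have *: "(d, ?d) \<in> R" "(?e, d) \<in> R" using trans_R by metis+
    have "?d \<in> pre k z" "?e \<in> post k z"
      using x'(2) y'(1) unfolding pre_def post_def i_def by blast+
    then have "?d \<in> core k z" "(?d, ?e) \<in> R"
      using * trans_R[OF *(2,1)] pre_post[OF k z] unfolding core_def by blast+
    moreover have "rank ?d = rank d"
      using *(1) trans_R[OF \<open>(?d, ?e) \<in> R\<close> *(2)] rank_both by blast
    ultimately show ?thesis using recurrent_label_iff[OF k z d] by blast
  qed
  show ?thesis
  proof (cases "k < h b")
    case False
    then have k: "k = h b" using leads_le[OF y(1)] by simp
    then have zy: "z = y" "y \<in> A (h b)" using y(1) by (auto simp: leads_same)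
    obtain y' where y': "y' \<in> A (h (Suc b))" "c (Suc b) y' = d"
      using c_surj R_in[OF d] by meson
    have "(c b y, d) \<in> R" using class_R[OF d c_in[OF zy(2)]] y(2) by simp
    then have "leads A N (h b) (h (Suc b)) y y'" using leads_iff zy(2) y' by auto
    then show ?thesis using main[of "Suc b" y'] h_less[of b "Suc b"] k zy y' by simp
  qed (use main y in blast)
qed

text \<open>
  Converse of \<open>sandwich\<close> with both ends taken in the window of the letter.
\<close>

lemma core_witness:
  assumes "h 0 \<le> k" "z \<in> A k" "(d, d) \<in> R" "label k z = point_label d"
  obtains x y where
    "leads A N (h (window k)) k x z" "rank (c (window k) x) = rank d"
    "leads A N k (h (Suc (window k))) z y" "rank (c (Suc (window k)) y) = rank d"
proof -
  obtain d' where d': "d' \<in> core k z" "rank d' = rank d"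
    using recurrent_label_iff[OF assms(1-3)] assms(4) by blast
  then obtain e where e: "d' \<in> pre k z" "e \<in> post k z" "(e, d') \<in> R" by (auto simp: core_def)
  then have "rank e = rank d"
    using pre_post[OF assms(1,2)] rank_both d'(2) by metis
  with d'(2) e that show ?thesis unfolding pre_def post_def by blast
qed

lemma recurrent_of_core:
  assumes "h 0 \<le> k" "z \<in> A k" "core k z \<noteq> {}"
  obtains d where "(d, d) \<in> R" "label k z = point_label d"
  using assms core_recurrent recurrent_label_iff by (metis all_not_in_conv)

text \<open>
  A path that keeps a pool label would meet the next time \<open>h i\<close> in a point \<open>e\<close> whose rank equals
  that of some predecessor \<open>d\<close> of its first letter. Since \<open>d\<close> leads to \<open>e\<close>, equal ranks put them in
  one class, and the first letter would lie on the stream of this class.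
\<close>

lemma pool_label_window:
  assumes k: "h 0 \<le> k" and zw: "leads A N k n z w" and win: "window k < window n"
    and core: "core k z = {}"
  shows "label k z \<noteq> label n w"
proof
  assume eq: "label k z = label n w"
  have z: "z \<in> A k" using zw by (rule leads_source)
  have n: "h 0 \<le> n" using k leads_le[OF zw] by simp
  let ?i = "Suc (window k)"
  have "h ?i \<le> n" using h_le[of ?i "window n"] window(1)[OF n] win by simp
  then obtain v where v: "leads A N k (h ?i) z v" "leads A N (h ?i) n v w"
    using leads_split[OF zw] window(2)[OF k] by (metis less_imp_le)
  have vA: "v \<in> A (h ?i)" using v(1) by (rule leads_target)
  let ?e = "c ?i v"
  have "label k z = label (h ?i) v"
    using label_mono[OF v(1)] label_mono[OF v(2)] eq by simp
  then have lab: "Suc (h 0 + (2 * max T (Max (rank ` pre k z)) + 1)) = point_label ?e"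
    using label_h[OF vA] label_no_core[OF k core] by simp
  have e: "(?e, ?e) \<notin> R"
  proof
    assume "(?e, ?e) \<in> R"
    then have "2 * max T (Max (rank ` pre k z)) + 1 = 2 * rank ?e"
      using lab by (simp add: point_label_def)
    then show False by presburger
  qed
  then have "T < rank ?e"
    using rank_not_initial[OF c_in[OF vA]] by (auto simp: initial_points_def)
  with lab e have "Max (rank ` pre k z) = rank ?e" by (simp add: point_label_def max_def split: if_splits)
  then obtain d where d: "d \<in> pre k z" "rank d = rank ?e"
    using Max_rank_pre[OF k z] by metis
  have "?e \<in> post k z" using v(1) by (auto simp: post_def)
  moreover have "(d, ?e) \<in> R" using pre_post[OF k z d(1) \<open>?e \<in> post k z\<close>] .
  ultimately have "d \<in> core k z" using rank_eq_R d by (auto simp: core_def)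
  with core show False by simp
qed

end

section \<open>The Frobenius normal form of an ordered sequence\<close>

definition level_set :: "(nat \<Rightarrow> 'a set) \<Rightarrow> (nat \<Rightarrow> 'a \<Rightarrow> nat) \<Rightarrow> nat \<Rightarrow> nat \<Rightarrow> 'a set" where
  "level_set A f k i = {x \<in> A k. f k x = i}"

lemma block_structure_level_set:
  fixes A :: "nat \<Rightarrow> 'a::linorder set"
  assumes "\<And>k x. x \<in> A k \<Longrightarrow> f k x \<in> {1..l}"
    and "\<And>k x y. x \<in> A k \<Longrightarrow> y \<in> A k \<Longrightarrow> f k x < f k y \<Longrightarrow> x < y"
  shows "block_structure A (\<lambda>k. l) (level_set A f)"
proof -
  have "(\<Union>i\<in>{1..l}. level_set A f k i) = A k" for k
    using assms(1) by (auto simp: level_set_def)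
  moreover have "disjoint_family_on (level_set A f k) {1..l}" for k
    by (auto simp: level_set_def disjoint_family_on_def)
  moreover have "level_set A f k i = {}" if "i \<notin> {1..l}" for k i
    using assms(1) that unfolding level_set_def by blast
  moreover have "x < y" if "i < j" "x \<in> level_set A f k i" "y \<in> level_set A f k j" for i j k x y
    using assms(2) that by (auto simp: level_set_def)
  ultimately show ?thesis unfolding block_structure_def by blast
qed

text \<open>
  The diagonal blocks of the gathered sequence are of this kind.
\<close>

lemma positive_blocks_reduced_primitive:
  assumes "\<And>k. finite (S k)" "\<And>k. S k \<noteq> {}"
    and pos: "\<And>k x y. x \<in> S k \<Longrightarrow> y \<in> S (Suc k) \<Longrightarrow> 0 < N k x y"
  shows "reduced S N \<and> primitive S N"
proof
  show "reduced S N"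
    unfolding reduced_def using assms(2) pos by (metis all_not_in_conv less_irrefl)
  show "primitive S N"
    unfolding primitive_def
  proof (intro allI exI[of _ "Suc k" for k] conjI ballI)
    fix k x y assume xy: "x \<in> S k" "y \<in> S (Suc (Suc k))"
    obtain z where "z \<in> S (Suc k)" using assms(2) by blast
    then have "leads S N k (Suc k) x z" "leads S N (Suc k) (Suc (Suc k)) z y"
      using xy pos by (auto simp: leads_edge)
    then have "leads S N k (Suc (Suc k)) x y" by (rule leads_trans)
    then show "0 < seq_prod S N k (Suc k) x y"
      using seq_prod_positive_iff_leads[of S N x k y "Suc k"] assms(1) less_imp_le[OF pos] xy
      by simp
  qed simp
qed

lemma initial_points_in: "d \<in> initial_points R \<Longrightarrow> (d, d) \<in> R"
  by (simp add: initial_points_def)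

context ramsey_frame
begin

lemma point_label_eq:
  assumes "d \<in> L" "e \<in> L" "point_label d = point_label e"
  shows "d = e \<or> (d, e) \<in> R \<and> (e, d) \<in> R"
proof -
  have "rank d = rank e"
    using assms(3) unfolding point_label_def
    by (cases "(d, d) \<in> R"; cases "(e, e) \<in> R"; simp; presburger)
  with assms rank_eq show ?thesis by blast
qed

lemma point_label_recurrent_eq:
  assumes "(d, d) \<in> R" "e \<in> L"
  shows "point_label e = point_label d \<longleftrightarrow> rank e = rank d"
proof
  assume "point_label e = point_label d"
  then show "rank e = rank d"
    using point_label_eq[OF assms(2) R_in(1)[OF assms(1)]] rank_both by auto
next
  assume "rank e = rank d"
  then have "(e, e) \<in> R" using class_R[OF assms] trans_R by blast
  with \<open>rank e = rank d\<close> assms(1) show "point_label e = point_label d"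
    by (simp add: point_label_def)
qed

lemma point_label_mono: "(d, e) \<in> R \<Longrightarrow> point_label d \<le> point_label e"
proof -
  assume de: "(d, e) \<in> R"
  show ?thesis
  proof (cases "rank d = rank e")
    case True
    then have "(d, d) \<in> R" "(e, e) \<in> R" using rank_eq_R[OF de] de trans_R by blast+
    with True show ?thesis by (simp add: point_label_def)
  qed (use rank_mono[OF de] in \<open>simp add: point_label_def\<close>)
qed

lemma finite_R: "finite R"
  using R_sub finite_L by (meson finite_SigmaI finite_subset)

lemma recurrent_below:
  assumes "d \<in> L"
  obtains r where "(r, r) \<in> R" "(r, d) \<in> R"
proof (rule recurrent_predecessor[OF finite_R trans_rel_R])
  show "Domain R \<subseteq> Range R" "d \<in> Range R" using assms R_pred R_in by blast+
qed (rule that)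

lemma recurrent_above:
  assumes "d \<in> L"
  obtains r where "(r, r) \<in> R" "(d, r) \<in> R"
proof (rule recurrent_predecessor[of "R\<inverse>" d])
  show "Domain (R\<inverse>) \<subseteq> Range (R\<inverse>)" "d \<in> Range (R\<inverse>)" using assms R_succ R_in by blast+
qed (use finite_R trans_rel_R that in auto)

end

text \<open>
  The letters are now sorted by their labels, and the blocks are the sets of constant label.
\<close>

locale ordered_frame = ramsey_frame A N h c L R rank T U
  for A :: "nat \<Rightarrow> 'a::linorder set" and N h c L R rank T U +
  assumes ordered: "\<And>k x y. x \<in> A k \<Longrightarrow> y \<in> A k \<Longrightarrow> label k x < label k y \<Longrightarrow> x < y"
begin

abbreviation blk :: "nat \<Rightarrow> nat \<Rightarrow> 'a set" where
  "blk \<equiv> level_set A label"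

definition block_count :: nat where
  "block_count = Suc (h 0 + (2 * max T (Max (rank ` L)) + 1))"

definition stream_labels :: "nat set" where
  "stream_labels = point_label ` {d. (d, d) \<in> R}"

lemma blk_time: "z \<in> blk k (point_label d) \<Longrightarrow> h 0 \<le> k"
  by (auto simp: level_set_def label_def point_label_def split: if_splits)

lemma stream_label_h:
  "(d, d) \<in> R \<Longrightarrow> x \<in> A (h i) \<Longrightarrow> x \<in> blk (h i) (point_label d) \<longleftrightarrow> rank (c i x) = rank d"
  using label_h point_label_recurrent_eq c_in by (auto simp: level_set_def)

lemma stream_nonempty:
  assumes "(d, d) \<in> R" "h 0 \<le> k"
  shows "blk k (point_label d) \<noteq> {}"
proof -
  let ?w = "window k"
  obtain x y where xy: "x \<in> A (h ?w)" "c ?w x = d" "y \<in> A (h (Suc ?w))" "c (Suc ?w) y = d"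
    using c_surj R_in[OF assms(1)] by meson
  then have "leads A N (h ?w) (h (Suc ?w)) x y" using leads_iff assms(1) by auto
  then obtain z where z: "leads A N (h ?w) k x z" "leads A N k (h (Suc ?w)) z y"
    using leads_split window[OF assms(2)] by (metis less_imp_le)
  have "label k z = point_label d"
    using sandwich[OF assms(1) lessI z(1) _ z(2)] xy by simp
  with leads_target[OF z(1)] show ?thesis by (auto simp: level_set_def)
qed

lemma stream_successor:
  assumes d: "(d, d) \<in> R" and z: "z \<in> blk k (point_label d)"
  shows "\<exists>z'\<in>blk (Suc k) (point_label d). N k z z' \<noteq> 0"
proof -
  have k: "h 0 \<le> k" and zA: "z \<in> A k" "label k z = point_label d"
    using blk_time[OF z] z by (auto simp: level_set_def)
  obtain x y where x: "leads A N (h (window k)) k x z" "rank (c (window k) x) = rank d"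
    and y: "leads A N k (h (Suc (window k))) z y" "rank (c (Suc (window k)) y) = rank d"
    using core_witness[OF k zA(1) d zA(2)] by metis
  obtain z' where z': "leads A N k (Suc k) z z'" "leads A N (Suc k) (h (Suc (window k))) z' y"
    using leads_split[OF y(1), of "Suc k"] window(2)[OF k] by auto
  have "label (Suc k) z' = point_label d"
    using sandwich[OF d lessI leads_trans[OF x(1) z'(1)] x(2) z'(2) y(2)] .
  with z'(1) show ?thesis by (auto simp: level_set_def leads_edge)
qed

text \<open>
  At a time \<open>k + 1 = h j\<close> the window of the letter starts at the letter itself and contains no path
  arriving at it. The required predecessor then comes from the preceding window, through the
  loop at \<open>d\<close>.
\<close>

lemma stream_predecessor:
  assumes d: "(d, d) \<in> R" and k: "h 0 \<le> k" and z': "z' \<in> blk (Suc k) (point_label d)"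
  shows "\<exists>z\<in>blk k (point_label d). N k z z' \<noteq> 0"
proof -
  have zA: "z' \<in> A (Suc k)" "label (Suc k) z' = point_label d" using z' by (auto simp: level_set_def)
  let ?j = "window (Suc k)"
  have k': "h 0 \<le> Suc k" using k by simp
  obtain x y where x: "leads A N (h ?j) (Suc k) x z'" "rank (c ?j x) = rank d"
    and y: "leads A N (Suc k) (h (Suc ?j)) z' y" "rank (c (Suc ?j) y) = rank d"
    using core_witness[OF k' zA(1) d zA(2)] by metis
  obtain a x' where x': "a < Suc ?j" "h a \<le> k" "leads A N (h a) (Suc k) x' z'" "rank (c a x') = rank d"
  proof (cases "h ?j \<le> k")
    case True
    with x that[of ?j x] show ?thesis by simp
  next
    case False
    then have hj: "h ?j = Suc k" using window(1)[OF k'] by simp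
    then have "x = z'" "z' \<in> A (h ?j)" using x(1) by (auto simp: leads_same)
    have "?j \<noteq> 0"
    proof
      assume "?j = 0"
      with hj have "h 0 = Suc k" by simp
      with k show False by simp
    qed
    then obtain a where a: "?j = Suc a" by (cases ?j) auto
    obtain x' where x': "x' \<in> A (h a)" "c a x' = d" using c_surj R_in[OF d] by meson
    have "(d, c ?j z') \<in> R"
      using class_R[OF d c_in[OF \<open>z' \<in> A (h ?j)\<close>]] x(2) \<open>x = z'\<close> by simp
    then have "leads A N (h a) (h ?j) x' z'"
      using leads_iff[of a ?j x' z'] x' a \<open>z' \<in> A (h ?j)\<close> by simp
    moreover have "h a \<le> k" using h_less[of a ?j] a hj by simp
    ultimately show ?thesis using that[of a x'] x' a hj by simp
  qed
  obtain z where z: "leads A N (h a) k x' z" "leads A N k (Suc k) z z'"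
    using leads_split[OF x'(3,2)] by auto
  have "label k z = point_label d"
    using sandwich[OF d x'(1) z(1) x'(4) leads_trans[OF z(2) y(1)] y(2)] .
  with z(2) show ?thesis by (auto simp: level_set_def leads_edge)
qed

text \<open>
  A stream letter reaches its class at the end of its window, and from there the class reaches all of
  itself one window later, because \<open>R\<close> is total on a class with a loop. All letters on the way are
  sandwiched, so the path stays in the stream.
\<close>

lemma stream_eventually_positive:
  assumes d: "(d, d) \<in> R" and k: "h 0 \<le> k"
    and z: "z \<in> blk k (point_label d)"
    and y: "y \<in> blk (h (Suc (Suc (window k)))) (point_label d)"
  shows "leads (stream blk (point_label d)) N k (h (Suc (Suc (window k)))) z y"
proof -
  let ?w = "window k"
  have zA: "z \<in> A k" "label k z = point_label d" using z by (auto simp: level_set_def)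
  obtain x v where x: "leads A N (h ?w) k x z" "rank (c ?w x) = rank d"
    and v: "leads A N k (h (Suc ?w)) z v" "rank (c (Suc ?w) v) = rank d"
    using core_witness[OF k zA(1) d zA(2)] by metis
  have yA: "y \<in> A (h (Suc (Suc ?w)))" using y by (auto simp: level_set_def)
  then have y': "rank (c (Suc (Suc ?w)) y) = rank d" using stream_label_h[OF d] y by simp
  have vA: "v \<in> A (h (Suc ?w))" using v(1) by (rule leads_target)
  have "(c (Suc ?w) v, c (Suc (Suc ?w)) y) \<in> R"
    using class_R[OF d c_in[OF vA] v(2)] class_R[OF d c_in[OF yA] y'] trans_R by blast
  then have "leads A N (h (Suc ?w)) (h (Suc (Suc ?w))) v y"
    using leads_iff vA yA by simp
  with v(1) have "leads A N k (h (Suc (Suc ?w))) z y" by (rule leads_trans)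
  then show ?thesis
  proof (rule leads_restrict)
    fix i u assume u: "leads A N k i z u" "leads A N i (h (Suc (Suc ?w))) u y"
    have "label i u = point_label d"
      using sandwich[OF d _ leads_trans[OF x(1) u(1)] x(2) u(2) y'] by simp
    with leads_target[OF u(1)] show "u \<in> stream blk (point_label d) i"
      by (simp add: stream_def level_set_def)
  qed
qed

lemma finite_blk: "finite (blk k i)"
  using finite_A by (simp add: level_set_def)

lemma stream_primitive_from:
  assumes d: "(d, d) \<in> R"
  shows "primitive_from N blk (point_label d) (h 0)"
  unfolding primitive_from_def
proof (intro conjI allI impI)
  let ?i = "point_label d"
  fix k assume "k < h 0"
  then have "blk k ?i = {}" using blk_time by fastforce
  then show "virtual_block blk k ?i ?i" by (simp add: virtual_block_def)
next
  let ?i = "point_label d" and ?S = "stream blk (point_label d)"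
  show "blk k ?i \<noteq> {}" if "h 0 \<le> k" for k using stream_nonempty[OF d that] .
  show "reduced (\<lambda>k. blk (h 0 + k) ?i) (\<lambda>k. N (h 0 + k))"
    unfolding reduced_def add_Suc_right
    using stream_successor[OF d] stream_predecessor[OF d le_add1] by blast
  show "primitive (\<lambda>k. blk (h 0 + k) ?i) (\<lambda>k. N (h 0 + k))"
    unfolding primitive_def
  proof
    fix k
    \<comment> \<open>Two windows later the whole class is reached.\<close>
    define m where "m = h (Suc (Suc (window (h 0 + k))))"
    have "h 0 + k < h (Suc (window (h 0 + k)))" using window(2) by simp
    moreover have "h (Suc (window (h 0 + k))) < m" unfolding m_def by (rule h_less) simp
    ultimately have m: "h 0 + Suc (m - h 0 - 1) = m" "k < m - h 0 - 1" by linarith+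
    show "\<exists>n>k. \<forall>x\<in>blk (h 0 + k) ?i. \<forall>y\<in>blk (h 0 + Suc n) ?i.
      0 < seq_prod (\<lambda>k. blk (h 0 + k) ?i) (\<lambda>k. N (h 0 + k)) k n x y"
    proof (intro exI conjI ballI)
      show "k < m - h 0 - 1" by (rule m(2))
      fix x y assume x: "x \<in> blk (h 0 + k) ?i" and y: "y \<in> blk (h 0 + Suc (m - h 0 - 1)) ?i"
      have "leads ?S N (h 0 + k) m x y"
        using stream_eventually_positive[OF d _ x] y m(1) unfolding m_def by simp
      then have "leads (\<lambda>k. ?S (h 0 + k)) (\<lambda>k. N (h 0 + k)) k (Suc (m - h 0 - 1)) x y"
        using m(1) by (simp only: leads_shift)
      then show "0 < seq_prod (\<lambda>k. blk (h 0 + k) ?i) (\<lambda>k. N (h 0 + k)) k (m - h 0 - 1) x y"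
        using seq_prod_positive_iff_leads[of "\<lambda>k. blk (h 0 + k) ?i" "\<lambda>k. N (h 0 + k)"
            x k y "m - h 0 - 1"] finite_blk nonneg x y m(2)
        by (simp add: stream_def level_set_def)
    qed
  qed
qed

lemma pool_label_no_core:
  assumes "h 0 \<le> k" "z \<in> blk k i" "i \<notin> stream_labels"
  shows "core k z = {}"
proof (rule ccontr)
  assume "core k z \<noteq> {}"
  with assms(2) obtain d where "(d, d) \<in> R" "label k z = point_label d"
    using recurrent_of_core[OF assms(1)] by (auto simp: level_set_def)
  moreover have "label k z = i" using assms(2) by (simp add: level_set_def)
  ultimately show False using assms(3) by (auto simp: stream_labels_def)
qed

text \<open>
  For a label used only before \<open>h 0\<close> every later block is empty; for the others the end of the window
  is a time which no path inside the block can pass.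
\<close>

lemma pool_labels:
  assumes i: "i \<notin> stream_labels"
  shows "pool_block N blk i"
  unfolding pool_block_def
proof
  fix k
  have "\<not> leads (stream blk i) N k (Suc n) x y"
    if n: "Suc k + h 0 + h (Suc (window k)) \<le> n" and x: "x \<in> blk k i" and y: "y \<in> blk (Suc n) i" for n x y
  proof
    assume "leads (stream blk i) N k (Suc n) x y"
    then have xy: "leads A N k (Suc n) x y"
      by (rule leads_mono) (auto simp: stream_def level_set_def)
    have eq: "label k x = label (Suc n) y" using x y by (simp add: level_set_def)
    show False
    proof (cases "h 0 \<le> k")
      case True
      have "Suc (window k) \<le> window (Suc n)" using True n by (intro window_ge) auto
      then show False
        using pool_label_window[OF True xy _ pool_label_no_core[OF True x i]] eq by simp
    next
      case False
      then show False using eq n by (auto simp: label_def split: if_splits)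
    qed
  qed
  then have "seq_prod (stream blk i) N k n x y = 0"
    if "Suc k + h 0 + h (Suc (window k)) \<le> n" "x \<in> blk k i" "y \<in> blk (Suc n) i" for n x y
    using that seq_prod_zero_iff_not_leads[of "stream blk i" N x k y n] finite_blk nonneg
    by (simp add: stream_def level_set_def)
  then show "\<exists>m>k. \<forall>n\<ge>m. blk k i = {} \<or> blk (Suc n) i = {} \<or>
      (\<forall>x\<in>blk k i. \<forall>y\<in>blk (Suc n) i. seq_prod (stream blk i) N k n x y = 0)"
    by (intro exI[of _ "Suc k + h 0 + h (Suc (window k))"]) auto
qed

lemma frobenius: "frobenius_normal_form A N (\<lambda>k. block_count) blk stream_labels"
  unfolding frobenius_normal_form_def
proof (intro conjI ballI allI impI)
  show "block_structure A (\<lambda>k. block_count) blk"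
    using label_bounds ordered unfolding block_count_def by (rule block_structure_level_set)
  show "stream_labels \<subseteq> (\<Union>k. {1..block_count})"
  proof
    fix i assume "i \<in> stream_labels"
    then obtain d where d: "(d, d) \<in> R" "i = point_label d" by (auto simp: stream_labels_def)
    then obtain x where "x \<in> A (h 0)" "c 0 x = d" using c_surj R_in by meson
    then show "i \<in> (\<Union>k. {1..block_count})"
      using label_h[of x 0] label_bounds[of x "h 0"] d unfolding block_count_def by simp
  qed
  show "\<exists>s. primitive_from N blk i s" if "i \<in> stream_labels" for i
    using that stream_primitive_from by (auto simp: stream_labels_def)
  show "pool_block N blk i" if "i \<in> (\<Union>k. {1..block_count}) - stream_labels" for i
    using that pool_labels by simp
  show "block_matrix N blk k i j = 0" if "j < i" for k i j
  proof -
    have "N k x y = 0" if "x \<in> blk k i" "y \<in> blk (Suc k) j" for x y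
    proof (rule ccontr)
      assume "N k x y \<noteq> 0"
      then have "leads A N k (Suc k) x y"
        using that nonneg[of x k y] by (auto simp: leads_edge level_set_def)
      then show False using label_mono that \<open>j < i\<close> by (fastforce simp: level_set_def)
    qed
    then show ?thesis by (auto simp: block_matrix_def)
  qed
qed

text \<open>
  A path from one stream to the other in a window gives a front connection: cut it at its last letter
  in the first stream and then at the first subsequent letter in the second. Such paths exist in every
  window or in none, as \<open>R\<close> is the pattern of all of them.
\<close>

lemma infinitely_front_connects_iff:
  assumes d: "(d, d) \<in> R" and e: "(e, e) \<in> R" and ne: "rank d \<noteq> rank e"
  shows "infinitely_front_connects A N (stream blk (point_label d)) (stream blk (point_label e))
    \<longleftrightarrow> (d, e) \<in> R"
proof
  assume "infinitely_front_connects A N (stream blk (point_label d)) (stream blk (point_label e))"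
  then obtain k n p where k: "h 0 \<le> k" "k < n" "vertex_path A N k n p"
    "p k \<in> blk k (point_label d)" "p n \<in> blk n (point_label e)"
    unfolding infinitely_front_connects_def front_connects_at_def stream_def by blast
  then have n: "h 0 \<le> n" and pk: "p k \<in> A k" "label k (p k) = point_label d"
    and pn: "p n \<in> A n" "label n (p n) = point_label e" and kn: "leads A N k n (p k) (p n)"
    by (auto simp: level_set_def leads_def intro: exI[of _ p])
  from core_witness[OF k(1) pk(1) d pk(2)]
  obtain x where x: "leads A N (h (window k)) k x (p k)" "rank (c (window k) x) = rank d" .
  from core_witness[OF n pn(1) e pn(2)]
  obtain y where y: "leads A N n (h (Suc (window n))) (p n) y" "rank (c (Suc (window n)) y) = rank e" .
  have "window k < Suc (window n)" using window_mono[OF k(1), of n] k(2) by simp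
  then have "(c (window k) x, c (Suc (window n)) y) \<in> R"
    using leads_R leads_trans[OF leads_trans[OF x(1) kn] y(1)] by blast
  then show "(d, e) \<in> R"
    using class_R[OF d _ x(2)] class_R[OF e _ y(2)] R_in trans_R by meson
next
  assume de: "(d, e) \<in> R"
  let ?X = "stream blk (point_label d)" and ?Y = "stream blk (point_label e)"
  have disj: "z \<notin> ?Y k" if "z \<in> ?X k" for z k
  proof
    assume "z \<in> ?Y k"
    with that have "point_label d = point_label e" by (simp add: stream_def level_set_def)
    then show False using point_label_recurrent_eq[OF e] R_in[OF d] ne by blast
  qed
  show "infinitely_front_connects A N ?X ?Y"
    unfolding infinitely_front_connects_def
  proof
    fix m
    obtain x y where x: "x \<in> A (h m)" "c m x = d" and y: "y \<in> A (h (Suc m))" "c (Suc m) y = e"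
      using c_surj R_in[OF d] R_in[OF e] by meson
    then have "leads A N (h m) (h (Suc m)) x y" using leads_iff de by auto
    then obtain p where p: "vertex_path A N (h m) (h (Suc m)) p" "p (h m) = x" "p (h (Suc m)) = y"
      by (auto simp: leads_def)
    have pX: "p (h m) \<in> ?X (h m)" and pY: "p (h (Suc m)) \<in> ?Y (h (Suc m))"
      using stream_label_h[OF d x(1)] stream_label_h[OF e y(1)] x y p by (auto simp: stream_def)
    \<comment> \<open>The last visit to the first stream, and the first later visit to the second.\<close>
    define K where "K = {k. h m \<le> k \<and> k \<le> h (Suc m) \<and> p k \<in> ?X k}"
    define k where "k = Max K"
    have fin: "finite K" by (rule finite_subset[of _ "{..h (Suc m)}"]) (auto simp: K_def)
    have "h m \<in> K" using pX h_le[of m "Suc m"] by (simp add: K_def)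
    then have "k \<in> K" unfolding k_def using fin by (intro Max_in) auto
    then have k: "h m \<le> k" "k \<le> h (Suc m)" "p k \<in> ?X k" by (auto simp: K_def)
    have last: "p i \<notin> ?X i" if "k < i" "i \<le> h (Suc m)" for i
      using Max_ge[OF fin, of i] that k(1) unfolding k_def[symmetric] by (auto simp: K_def)
    have "k \<noteq> h (Suc m)" using disj k(3) pY by blast
    then have k': "k < h (Suc m)" using k(2) by simp
    define n where "n = (LEAST n. k < n \<and> p n \<in> ?Y n)"
    have n: "k < n" "p n \<in> ?Y n"
      using LeastI[of "\<lambda>n. k < n \<and> p n \<in> ?Y n" "h (Suc m)"] k' pY unfolding n_def by auto
    have n_le: "n \<le> h (Suc m)" unfolding n_def using k' pY by (intro Least_le) simp
    have first: "p i \<notin> ?Y i" if "k < i" "i < n" for i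
      using not_less_Least[of i "\<lambda>n. k < n \<and> p n \<in> ?Y n"] that unfolding n_def by blast
    have "vertex_path A N k n p"
      using p(1) k(1) n_le unfolding vertex_path_def by auto
    then have "front_connects_at A N ?X ?Y k"
      unfolding front_connects_at_def using n n_le k(3) first last
      by (intro exI[of _ n] exI[of _ p]) auto
    moreover have "m \<le> k" using h_ge[of m] k(1) by simp
    ultimately show "\<exists>k\<ge>m. front_connects_at A N ?X ?Y k" by blast
  qed
qed

text \<open>
  Streams are classes with a loop, but minimality in \<open>R\<close> concerns all predecessors. They agree
  since any predecessor lies above a class with a loop.
\<close>

lemma initial_indices_eq: "initial_indices A N blk stream_labels = point_label ` initial_points R"
proof -
  have "(\<forall>j\<in>stream_labels - {point_label d}.
      \<not> infinitely_front_connects A N (stream blk j) (stream blk (point_label d)))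
    \<longleftrightarrow> d \<in> initial_points R" if d: "(d, d) \<in> R" for d
  proof
    assume *: "\<forall>j\<in>stream_labels - {point_label d}.
      \<not> infinitely_front_connects A N (stream blk j) (stream blk (point_label d))"
    have "(d, e) \<in> R" if e: "(e, d) \<in> R" for e
    proof -
      obtain r where r: "(r, r) \<in> R" "(r, e) \<in> R" using recurrent_below R_in[OF e] by metis
      have rd: "(r, d) \<in> R" using r(2) e by (rule trans_R)
      have "rank r = rank d"
      proof (rule ccontr)
        assume ne: "rank r \<noteq> rank d"
        then have "point_label r \<in> stream_labels - {point_label d}"
          using point_label_recurrent_eq[OF d] R_in[OF r(1)] r(1) by (auto simp: stream_labels_def)
        with * infinitely_front_connects_iff[OF r(1) d ne] rd show False by blast
      qed
      then have "(d, r) \<in> R" using rank_eq_R[OF rd] by simp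
      with r(2) show ?thesis using trans_R by blast
    qed
    with d show "d \<in> initial_points R" by (auto simp: initial_points_def)
  next
    assume init: "d \<in> initial_points R"
    show "\<forall>j\<in>stream_labels - {point_label d}.
      \<not> infinitely_front_connects A N (stream blk j) (stream blk (point_label d))"
    proof
      fix j assume "j \<in> stream_labels - {point_label d}"
      then obtain e where e: "(e, e) \<in> R" "j = point_label e" "point_label e \<noteq> point_label d"
        by (auto simp: stream_labels_def)
      then have ne: "rank e \<noteq> rank d" using point_label_recurrent_eq[OF d] R_in by blast
      have "(e, d) \<notin> R" using init ne rank_both by (auto simp: initial_points_def)
      then show "\<not> infinitely_front_connects A N (stream blk j) (stream blk (point_label d))"
        using infinitely_front_connects_iff[OF e(1) d ne] e(2) by simp
    qed
  qed
  then show ?thesis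
    unfolding initial_indices_def stream_labels_def
    using initial_points_in[of _ R] by (auto simp del: Diff_iff)
qed

lemma final_indices_eq: "final_indices A N blk stream_labels = point_label ` initial_points (R\<inverse>)"
proof -
  have "(\<forall>j\<in>stream_labels - {point_label d}.
      \<not> infinitely_front_connects A N (stream blk (point_label d)) (stream blk j))
    \<longleftrightarrow> d \<in> initial_points (R\<inverse>)" if d: "(d, d) \<in> R" for d
  proof
    assume *: "\<forall>j\<in>stream_labels - {point_label d}.
      \<not> infinitely_front_connects A N (stream blk (point_label d)) (stream blk j)"
    have "(e, d) \<in> R" if e: "(d, e) \<in> R" for e
    proof -
      obtain r where r: "(r, r) \<in> R" "(e, r) \<in> R" using recurrent_above R_in[OF e] by metis
      have rd: "(d, r) \<in> R" using e r(2) by (rule trans_R)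
      have "rank d = rank r"
      proof (rule ccontr)
        assume ne: "rank d \<noteq> rank r"
        then have "point_label r \<in> stream_labels - {point_label d}"
          using point_label_recurrent_eq[OF d] R_in[OF r(1)] r(1) by (auto simp: stream_labels_def)
        with * infinitely_front_connects_iff[OF d r(1) ne] rd show False by blast
      qed
      then have "(r, d) \<in> R" using rank_eq_R[OF rd] by simp
      with r(2) show ?thesis using trans_R by blast
    qed
    with d show "d \<in> initial_points (R\<inverse>)" by (auto simp: initial_points_def)
  next
    assume final: "d \<in> initial_points (R\<inverse>)"
    show "\<forall>j\<in>stream_labels - {point_label d}.
      \<not> infinitely_front_connects A N (stream blk (point_label d)) (stream blk j)"
    proof
      fix j assume "j \<in> stream_labels - {point_label d}"
      then obtain e where e: "(e, e) \<in> R" "j = point_label e" "point_label e \<noteq> point_label d"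
        by (auto simp: stream_labels_def)
      then have ne: "rank d \<noteq> rank e" using point_label_recurrent_eq[OF d] R_in by metis
      have "(d, e) \<notin> R" using final ne rank_both by (auto simp: initial_points_def)
      then show "\<not> infinitely_front_connects A N (stream blk (point_label d)) (stream blk j)"
        using infinitely_front_connects_iff[OF d e(1) ne] e(2) by simp
    qed
  qed
  then show ?thesis
    unfolding final_indices_def stream_labels_def
    using initial_points_in[of _ "R\<inverse>"] by (auto simp del: Diff_iff)
qed

end

context ordered_frame
begin

section \<open>Initial streams first, final streams last\<close>

lemma label_initial: "d \<in> initial_points R \<Longrightarrow> point_label d < Suc (h 0 + 2 * T)"
  using rank_initial[of d] R_in initial_points_in[of d R] by (auto simp: point_label_def)

lemma label_not_initial:
  assumes k: "h 0 \<le> k" and y: "y \<in> A k" and "label k y \<notin> point_label ` initial_points R"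
  shows "Suc (h 0 + 2 * T) < label k y"
proof (cases "core k y = {}")
  case True
  then show ?thesis using label_no_core[OF k, of y] by simp
next
  case False
  then obtain d where d: "(d, d) \<in> R" "label k y = point_label d"
    using recurrent_of_core[OF k y] by metis
  then have "T < rank d" using rank_not_initial[of d] R_in assms(3) by blast
  with d show ?thesis by (simp add: point_label_def)
qed

lemma label_final:
  "d \<in> initial_points (R\<inverse>) - initial_points R \<Longrightarrow> Suc (h 0 + 2 * U + 1) < point_label d"
  using rank_final[of d] R_in initial_points_in[of d "R\<inverse>"] by (auto simp: point_label_def)

text \<open>
  A pool letter has no predecessor in a final class, for that class would receive a path back from it
  and the letter would be on the stream.
\<close>

lemma label_not_final:
  assumes x: "x \<in> A k"
    and not_final: "label k x \<notin> point_label ` (initial_points (R\<inverse>) - initial_points R)"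
  shows "label k x \<le> Suc (h 0 + 2 * U + 1)"
proof (cases "h 0 \<le> k")
  case k: True
  show ?thesis
  proof (cases "core k x = {}")
    case True
    obtain d where d: "d \<in> pre k x" "rank d = Max (rank ` pre k x)"
      using Max_rank_pre[OF k x] by blast
    obtain e where e: "e \<in> post k x" using post_nonempty[OF k x] by blast
    have "d \<notin> initial_points (R\<inverse>)"
    proof
      assume "d \<in> initial_points (R\<inverse>)"
      then have "(e, d) \<in> R" using pre_post[OF k x d(1) e] by (auto simp: initial_points_def)
      then have "d \<in> core k x" using d(1) e by (auto simp: core_def)
      with True show False by simp
    qed
    then have "rank d < U" using rank_not_final[of d] d(1) pre_in_L by blast
    then show ?thesis using label_no_core[OF k True] d(2) T_le_U by simp
  next
    case False
    then obtain d where d: "(d, d) \<in> R" "label k x = point_label d"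
      using recurrent_of_core[OF k x] by metis
    then have "rank d < U" using rank_not_final[of d] R_in not_final by blast
    with d show ?thesis by (simp add: point_label_def)
  qed
qed (simp add: label_def)

lemma initial_first: "initial_first_final_last A N blk stream_labels"
  unfolding initial_first_final_last_def initial_indices_eq final_indices_eq
proof (intro exI conjI allI ballI)
  let ?I = "point_label ` initial_points R"
  let ?F = "point_label ` (initial_points (R\<inverse>) - initial_points R)"
  have "point_label d \<noteq> point_label e"
    if "d \<in> initial_points R" "e \<in> initial_points (R\<inverse>) - initial_points R" for d e
    using label_initial[OF that(1)] label_final[OF that(2)] T_le_U by simp
  then have "?I \<inter> ?F = {}" by blast
  then show "extremal_choice ?I (point_label ` initial_points (R\<inverse>)) ?I ?F"
    unfolding extremal_choice_def by blast
  show "x < y" if xy: "x \<in> (\<Union>i\<in>?I. blk k i)" "y \<in> A k - (\<Union>i\<in>?I. blk k i)" for k x y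
  proof -
    obtain d where d: "d \<in> initial_points R" "x \<in> blk k (point_label d)" using xy(1) by blast
    have k: "h 0 \<le> k" using d(2) by (rule blk_time)
    have "Suc (h 0 + 2 * T) < label k y"
      using xy(2) by (intro label_not_initial[OF k]) (auto simp: level_set_def)
    then have "label k x < label k y"
      using label_initial[OF d(1)] d(2) by (simp add: level_set_def)
    then show ?thesis using ordered xy(2) d(2) by (auto simp: level_set_def)
  qed
  show "x < y" if xy: "y \<in> (\<Union>i\<in>?F. blk k i)" "x \<in> A k - (\<Union>i\<in>?F. blk k i)" for k x y
  proof -
    obtain d where d: "d \<in> initial_points (R\<inverse>) - initial_points R" "y \<in> blk k (point_label d)"
      using xy(1) by blast
    have "label k x \<le> Suc (h 0 + 2 * U + 1)"
      using xy(2) by (intro label_not_final) (auto simp: level_set_def)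
    then have "label k x < label k y"
      using label_final[OF d(1)] d(2) by (simp add: level_set_def)
    then show ?thesis using ordered xy(2) d(2) by (auto simp: level_set_def)
  qed
qed

section \<open>The gathered sequence\<close>

text \<open>
  A gathering has to start at time \<open>0\<close>, whose alphabet may have a different size. Dropping the first
  product is the reason why the fixed-size form starts at time \<open>1\<close>.
\<close>

definition gather_times :: "nat \<Rightarrow> nat" where
  "gather_times k = (if k = 0 then 0 else h k)"

lemma gathered_pos_iff:
  assumes "x \<in> A (gather_times (Suc k))" "y \<in> A (gather_times (Suc (Suc k)))"
  shows "0 \<le> gathered A N gather_times (Suc k) x y \<and>
    (0 < gathered A N gather_times (Suc k) x y \<longleftrightarrow> (c (Suc k) x, c (Suc (Suc k)) y) \<in> R)"
proof -
  define n where "n = h (Suc (Suc k)) - 1"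
  have less: "h (Suc k) < h (Suc (Suc k))" by (rule h_less) simp
  then have n: "Suc n = h (Suc (Suc k))" "h (Suc k) \<le> n" by (auto simp: n_def)
  have xy: "x \<in> A (h (Suc k))" "y \<in> A (h (Suc (Suc k)))" using assms by (auto simp: gather_times_def)
  have "gathered A N gather_times (Suc k) = seq_prod A N (h (Suc k)) n"
    by (simp add: gathered_def gather_times_def n_def)
  then show ?thesis
    using seq_prod_positive_iff_leads[of A N x "h (Suc k)" y n] finite_A nonneg xy n
      leads_iff[of "Suc k" "Suc (Suc k)" x y]
    by simp
qed

text \<open>
  All gathered matrices have the pattern \<open>R\<close>. Classes with a loop give positive diagonal blocks, and
  each remaining point is alone in its block, with entry \<open>0\<close>. A column of the block matrix
  consists of the diagonal entry alone precisely when the class is minimal, a row when it is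
  maximal.
\<close>

lemma fixed_size:
  "\<exists>t l blk' P'. gathering_times t \<and>
     fixed_size_frobenius_normal_form (\<lambda>k. A (t (Suc k))) (\<lambda>k. gathered A N t (Suc k)) l blk' P'"
proof -
  define V where "V = point_label ` L"
  have finV: "finite V" using finite_L by (simp add: V_def)
  define l where "l = card V"
  obtain pos where pos: "pos ` V = {1..l}"
    "\<And>u v. u \<in> V \<Longrightarrow> v \<in> V \<Longrightarrow> pos u < pos v \<longleftrightarrow> u < v"
    using order_index[OF finV] unfolding l_def by blast
  define A' where "A' k = A (gather_times (Suc k))" for k
  define N' where "N' k = gathered A N gather_times (Suc k)" for k
  define g where "g k = c (Suc k)" for k
  define idx where "idx d = pos (point_label d)" for d
  define f where "f k x = idx (g k x)" for k x
  define B where "B = level_set A' f"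
  define Q where "Q = idx ` {d. (d, d) \<in> R}"

  have A'_eq: "A' k = A (h (Suc k))" for k by (simp add: A'_def gather_times_def)
  have g: "bij_betw (g k) (A' k) L" for k unfolding g_def A'_eq by (rule c_bij)
  have g_in: "g k x \<in> L" if "x \<in> A' k" for k x using g that by (auto simp: bij_betw_def)
  have g_surj: "\<exists>x\<in>A' k. g k x = d" if "d \<in> L" for k d
    using g[of k] that unfolding bij_betw_def by blast
  have finA': "finite (A' k)" for k using finite_A by (simp add: A'_def)
  have N'_pos: "0 \<le> N' k x y" "0 < N' k x y \<longleftrightarrow> (g k x, g (Suc k) y) \<in> R"
    if "x \<in> A' k" "y \<in> A' (Suc k)" for k x y
    using gathered_pos_iff[of x k y] that unfolding A'_def N'_def g_def by auto
  have N'_nz: "N' k x y \<noteq> 0 \<longleftrightarrow> (g k x, g (Suc k) y) \<in> R"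
    if "x \<in> A' k" "y \<in> A' (Suc k)" for k x y
    using N'_pos[OF that] by linarith
  have idx_less: "idx d < idx e \<longleftrightarrow> point_label d < point_label e" if "d \<in> L" "e \<in> L" for d e
    using pos(2) that by (simp add: idx_def V_def)
  have idx_eq: "idx d = idx e \<longleftrightarrow> point_label d = point_label e" if "d \<in> L" "e \<in> L" for d e
    using idx_less[OF that] idx_less[OF that(2,1)] by (metis less_irrefl nat_neq_iff)
  have idx_img: "idx ` L = {1..l}" using pos(1) by (simp add: idx_def V_def image_image)
  have idx_surj: "\<exists>d\<in>L. i = idx d" if "i \<in> {1..l}" for i
  proof -
    have "i \<in> idx ` L" using that by (simp only: idx_img)
    then show ?thesis by blast
  qed
  have idx_R: "idx d \<le> idx e" if "(d, e) \<in> R" for d e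
    using point_label_mono[OF that] idx_less[of e d] R_in[OF that] by (meson not_less)
  have idx_class: "d = e \<or> (d, e) \<in> R \<and> (e, d) \<in> R" if "d \<in> L" "e \<in> L" "idx d = idx e" for d e
    using point_label_eq[OF that(1,2)] idx_eq[OF that(1,2)] that(3) by simp
  have idx_rec: "(d, d) \<in> R" if "(d, e) \<in> R" "idx d = idx e" for d e
    using idx_class[OF R_in[OF that(1)] that(2)] that(1) trans_R by blast
  have idx_rec': "(e, e) \<in> R \<and> (d, e) \<in> R \<and> (e, d) \<in> R"
    if "(d, d) \<in> R" "e \<in> L" "idx e = idx d" for d e
    using idx_class[OF that(2) R_in(1)[OF that(1)] that(3)] that(1) trans_R by blast
  have mem_B: "x \<in> B k i \<longleftrightarrow> x \<in> A' k \<and> idx (g k x) = i" for x k i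
    by (auto simp: B_def level_set_def f_def)
  have B_ne: "B k i \<noteq> {}" if i: "i \<in> {1..l}" for k i
  proof -
    obtain d where "d \<in> L" "i = idx d" using idx_surj[OF i] by blast
    then show ?thesis using g_surj[of d k] mem_B by blast
  qed
  have card_B: "card (B k i) = card {d \<in> L. idx d = i}" for k i
  proof -
    have "bij_betw (g k) (B k i) {d \<in> L. idx d = i}"
      unfolding bij_betw_def
    proof
      show "inj_on (g k) (B k i)"
      proof (rule inj_on_subset)
        show "inj_on (g k) (A' k)" using g by (simp add: bij_betw_def)
        show "B k i \<subseteq> A' k" by (auto simp: mem_B)
      qed
      show "g k ` B k i = {d \<in> L. idx d = i}"
      proof
        show "g k ` B k i \<subseteq> {d \<in> L. idx d = i}" using g_in mem_B by blast
        show "{d \<in> L. idx d = i} \<subseteq> g k ` B k i"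
        proof
          fix d assume "d \<in> {d \<in> L. idx d = i}"
          moreover from this obtain x where "x \<in> A' k" "g k x = d" using g_surj by blast
          ultimately show "d \<in> g k ` B k i" by (auto simp: mem_B)
        qed
      qed
    qed
    then show ?thesis by (rule bij_betw_same_card)
  qed
  have B_fin: "finite (B k i)" for k i using finA' by (simp add: B_def level_set_def)
  have Q_sub: "Q \<subseteq> {1..l}" using idx_img R_in unfolding Q_def by blast
  have Q_pos: "0 < N' k x y" if "i \<in> Q" "x \<in> B k i" "y \<in> B (Suc k) i" for i k x y
  proof -
    obtain d where d: "(d, d) \<in> R" "idx d = i" using \<open>i \<in> Q\<close> by (auto simp: Q_def)
    have "(g k x, d) \<in> R" "(d, g (Suc k) y) \<in> R"
      using idx_rec'[OF d(1) g_in] that d(2) mem_B by simp_all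
    then show ?thesis using N'_pos(2) that mem_B trans_R by metis
  qed
  have Q_prim: "reduced (stream B i) N' \<and> primitive (stream B i) N'" if "i \<in> Q" for i
    using that Q_sub B_fin B_ne Q_pos unfolding stream_def
    by (intro positive_blocks_reduced_primitive) blast+
  have nQ_zero: "N' k x y = 0" if "i \<notin> Q" "x \<in> B k i" "y \<in> B (Suc k) i" for i k x y
  proof (rule ccontr)
    assume "N' k x y \<noteq> 0"
    then have "(g k x, g (Suc k) y) \<in> R" using N'_nz that mem_B by blast
    then have "(g k x, g k x) \<in> R" using idx_rec that mem_B by metis
    with that show False by (auto simp: Q_def mem_B)
  qed
  have frob: "frobenius_normal_form A' N' (\<lambda>k. l) B Q"
    unfolding frobenius_normal_form_def
  proof (intro conjI ballI allI impI)
    show "block_structure A' (\<lambda>k. l) B"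
      unfolding B_def
    proof (rule block_structure_level_set)
      show "f k x \<in> {1..l}" if "x \<in> A' k" for k x
        using idx_img g_in[OF that] by (auto simp: f_def)
      show "x < y" if xy: "x \<in> A' k" "y \<in> A' k" "f k x < f k y" for k x y
      proof -
        have "point_label (g k x) < point_label (g k y)"
          using idx_less[OF g_in[OF xy(1)] g_in[OF xy(2)]] xy(3) by (simp add: f_def)
        then show ?thesis
          using xy label_h ordered unfolding A'_eq g_def by simp
      qed
    qed
    show "Q \<subseteq> (\<Union>k::nat. {1..l})" using Q_sub by simp
    show "\<exists>s. primitive_from N' B i s" if "i \<in> Q" for i
      using Q_prim[OF that] B_ne Q_sub that unfolding stream_def
      by (intro exI[of _ 0]) (auto simp: primitive_from_def)
    show "pool_block N' B i" if "i \<in> (\<Union>k::nat. {1..l}) - Q" for i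
      unfolding pool_block_def
    proof
      fix k
      have "seq_prod (stream B i) N' k n x y = 0"
        if n: "Suc k \<le> n" and xy: "x \<in> B k i" "y \<in> B (Suc n) i" for n x y
      proof -
        have "\<not> leads (stream B i) N' k (Suc n) x y"
        proof
          assume "leads (stream B i) N' k (Suc n) x y"
          then obtain v where "leads (stream B i) N' k (Suc k) x v"
            using leads_split[of "stream B i" N' k "Suc n" x y "Suc k"] n by auto
          then show False
            using nQ_zero[of i x k v] \<open>i \<in> _ - Q\<close> by (auto simp: leads_edge stream_def)
        qed
        then show ?thesis
          using seq_prod_zero_iff_not_leads[of "stream B i" N' x k y n] B_fin N'_pos(1) xy n
          by (simp add: stream_def mem_B)
      qed
      then show "\<exists>m>k. \<forall>n\<ge>m. B k i = {} \<or> B (Suc n) i = {} \<or>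
        (\<forall>x\<in>B k i. \<forall>y\<in>B (Suc n) i. seq_prod (stream B i) N' k n x y = 0)"
        by (intro exI[of _ "Suc k"]) auto
    qed
    show "block_matrix N' B k i j = 0" if "j < i" for k i j
    proof -
      have "N' k x y = 0" if "x \<in> B k i" "y \<in> B (Suc k) j" for x y
      proof (rule ccontr)
        assume "N' k x y \<noteq> 0"
        then have "(g k x, g (Suc k) y) \<in> R" using N'_nz that mem_B by blast
        then have "idx (g k x) \<le> idx (g (Suc k) y)" by (rule idx_R)
        then have "i \<le> j" using that by (simp add: mem_B)
        with \<open>j < i\<close> show False by simp
      qed
      then show ?thesis by (auto simp: block_matrix_def)
    qed
  qed
  have matrix_iff: "block_matrix N' B k (idx d) (idx e) = 1 \<longleftrightarrow>
      (\<exists>d'\<in>L. \<exists>e'\<in>L. idx d' = idx d \<and> idx e' = idx e \<and> (d', e') \<in> R)" for k d e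
  proof -
    have "block_matrix N' B k (idx d) (idx e) = 1 \<longleftrightarrow>
      (\<exists>x\<in>B k (idx d). \<exists>y\<in>B (Suc k) (idx e). (g k x, g (Suc k) y) \<in> R)"
      using N'_nz mem_B by (auto simp: block_matrix_def)
    also have "\<dots> \<longleftrightarrow> (\<exists>d'\<in>L. \<exists>e'\<in>L. idx d' = idx d \<and> idx e' = idx e \<and> (d', e') \<in> R)"
    proof
      assume "\<exists>x\<in>B k (idx d). \<exists>y\<in>B (Suc k) (idx e). (g k x, g (Suc k) y) \<in> R"
      then show "\<exists>d'\<in>L. \<exists>e'\<in>L. idx d' = idx d \<and> idx e' = idx e \<and> (d', e') \<in> R"
        using g_in mem_B by blast
    next
      assume "\<exists>d'\<in>L. \<exists>e'\<in>L. idx d' = idx d \<and> idx e' = idx e \<and> (d', e') \<in> R"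
      then obtain d' e' where "d' \<in> L" "e' \<in> L" "idx d' = idx d" "idx e' = idx e" "(d', e') \<in> R"
        by blast
      moreover from this obtain x y where "x \<in> A' k" "g k x = d'" "y \<in> A' (Suc k)" "g (Suc k) y = e'"
        using g_surj by meson
      ultimately have "x \<in> B k (idx d)" "y \<in> B (Suc k) (idx e)" "(g k x, g (Suc k) y) \<in> R"
        by (simp_all add: mem_B)
      then show "\<exists>x\<in>B k (idx d). \<exists>y\<in>B (Suc k) (idx e). (g k x, g (Suc k) y) \<in> R" by blast
    qed
    finally show ?thesis .
  qed
  have matrix_01: "block_matrix N' B k i j = 0 \<or> block_matrix N' B k i j = 1" for k i j
    by (simp add: block_matrix_def)
  have rec_of_diag: "(d, d) \<in> R" if d: "d \<in> L" "block_matrix N' B 0 (idx d) (idx d) = 1" for d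
  proof -
    obtain d' e' where "d' \<in> L" "idx d' = idx d" "idx e' = idx d" "(d', e') \<in> R"
      using d(2) matrix_iff by blast
    then have "(d', d') \<in> R" using idx_rec by metis
    then show ?thesis using idx_rec'[of d' d] d \<open>idx d' = idx d\<close> by simp
  qed
  have cols: "initial_columns N' B l = idx ` initial_points R"
  proof (intro set_eqI iffI)
    fix i assume "i \<in> initial_columns N' B l"
    then have i: "i \<in> {1..l}" "\<And>k j. j \<in> {1..l} \<Longrightarrow> block_matrix N' B k j i = (if j = i then 1 else 0)"
      by (auto simp: initial_columns_def)
    then obtain d where d: "d \<in> L" "i = idx d" using idx_surj[OF i(1)] by blast
    have rec: "(d, d) \<in> R" using rec_of_diag[OF d(1)] i(2)[of i 0] i(1) d(2) by simp
    have "(d, e) \<in> R" if e: "(e, d) \<in> R" for e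
    proof -
      have eL: "e \<in> L" using R_in[OF e] by simp
      have "block_matrix N' B 0 (idx e) i = 1" using matrix_iff[of 0] e eL d by blast
      moreover have "idx e \<in> {1..l}" using idx_img eL by blast
      ultimately have "idx e = idx d" using i(2)[of "idx e" 0] d(2) by (simp split: if_splits)
      then show ?thesis using idx_rec'[OF rec eL] by blast
    qed
    then show "i \<in> idx ` initial_points R" using d rec by (auto simp: initial_points_def)
  next
    fix i assume "i \<in> idx ` initial_points R"
    then obtain d where d: "d \<in> initial_points R" "i = idx d" by blast
    have rec: "(d, d) \<in> R" using initial_points_in[OF d(1)] .
    have dL: "d \<in> L" using R_in(1)[OF rec] .
    have "block_matrix N' B k j i = (if j = i then 1 else 0)" if j: "j \<in> {1..l}" for k j
    proof (cases "j = i")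
      case True
      then show ?thesis using matrix_iff[of k d d] rec dL d(2) by auto
    next
      case False
      obtain e where e: "e \<in> L" "j = idx e" using idx_surj[OF j] by blast
      have "block_matrix N' B k j i \<noteq> 1"
      proof
        assume "block_matrix N' B k j i = 1"
        then obtain e' d' where *: "e' \<in> L" "d' \<in> L" "idx e' = j" "idx d' = i" "(e', d') \<in> R"
          using matrix_iff[of k] e(2) d(2) by blast
        then have "(d', d) \<in> R" using idx_rec'[OF rec] d(2) by blast
        then have ed: "(e', d) \<in> R" using *(5) trans_R by blast
        then have "(d, e') \<in> R" using d(1) by (simp add: initial_points_def)
        then have "idx e' = idx d" using idx_R ed by (meson antisym)
        with * False d(2) show False by simp
      qed
      then show ?thesis using matrix_01 False by metis
    qed
    moreover have "i \<in> {1..l}" using idx_img dL d(2) by blast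
    ultimately show "i \<in> initial_columns N' B l" by (simp add: initial_columns_def)
  qed
  have rows: "final_rows N' B l = idx ` initial_points (R\<inverse>)"
  proof (intro set_eqI iffI)
    fix i assume "i \<in> final_rows N' B l"
    then have i: "i \<in> {1..l}" "\<And>k j. j \<in> {1..l} \<Longrightarrow> block_matrix N' B k i j = (if j = i then 1 else 0)"
      by (auto simp: final_rows_def)
    then obtain d where d: "d \<in> L" "i = idx d" using idx_surj[OF i(1)] by blast
    have rec: "(d, d) \<in> R" using rec_of_diag[OF d(1)] i(2)[of i 0] i(1) d(2) by simp
    have "(e, d) \<in> R" if e: "(d, e) \<in> R" for e
    proof -
      have eL: "e \<in> L" using R_in[OF e] by simp
      have "block_matrix N' B 0 i (idx e) = 1" using matrix_iff[of 0] e eL d by blast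
      moreover have "idx e \<in> {1..l}" using idx_img eL by blast
      ultimately have "idx e = idx d" using i(2)[of "idx e" 0] d(2) by (simp split: if_splits)
      then show ?thesis using idx_rec'[OF rec eL] by blast
    qed
    then show "i \<in> idx ` initial_points (R\<inverse>)" using d rec by (auto simp: initial_points_def)
  next
    fix i assume "i \<in> idx ` initial_points (R\<inverse>)"
    then obtain d where d: "d \<in> initial_points (R\<inverse>)" "i = idx d" by blast
    have rec: "(d, d) \<in> R" using initial_points_in[OF d(1)] by simp
    have dL: "d \<in> L" using R_in(1)[OF rec] .
    have "block_matrix N' B k i j = (if j = i then 1 else 0)" if j: "j \<in> {1..l}" for k j
    proof (cases "j = i")
      case True
      then show ?thesis using matrix_iff[of k d d] rec dL d(2) by auto
    next
      case False
      obtain e where e: "e \<in> L" "j = idx e" using idx_surj[OF j] by blast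
      have "block_matrix N' B k i j \<noteq> 1"
      proof
        assume "block_matrix N' B k i j = 1"
        then obtain e' d' where *: "e' \<in> L" "d' \<in> L" "idx e' = j" "idx d' = i" "(d', e') \<in> R"
          using matrix_iff[of k] e(2) d(2) by blast
        then have "(d, d') \<in> R" using idx_rec'[OF rec] d(2) by blast
        then have de: "(d, e') \<in> R" using *(5) trans_R by blast
        then have "(e', d) \<in> R" using d(1) by (simp add: initial_points_def)
        then have "idx e' = idx d" using idx_R de by (meson antisym)
        with * False d(2) show False by simp
      qed
      then show ?thesis using matrix_01 False by metis
    qed
    moreover have "i \<in> {1..l}" using idx_img dL d(2) by blast
    ultimately show "i \<in> final_rows N' B l" by (simp add: final_rows_def)
  qed
  let ?I = "idx ` initial_points R"
  let ?F = "idx ` (initial_points (R\<inverse>) - initial_points R)"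
  have inL: "d \<in> L" if "d \<in> initial_points R \<or> d \<in> initial_points (R\<inverse>)" for d
    using that initial_points_in[of d R] initial_points_in[of d "R\<inverse>"] R_in by blast
  have choice: "extremal_choice (initial_columns N' B l) (final_rows N' B l) ?I ?F"
  proof -
    have "idx d \<noteq> idx e"
      if "d \<in> initial_points R" "e \<in> initial_points (R\<inverse>) - initial_points R" for d e
      using label_initial[OF that(1)] label_final[OF that(2)] T_le_U idx_eq[of d e] inL that by auto
    then have "?I \<inter> ?F = {}" by blast
    then show ?thesis unfolding cols rows extremal_choice_def by blast
  qed
  have label_point: "\<exists>x\<in>A (h 0). label (h 0) x = point_label d" if "d \<in> L" for d
    using c_surj[OF that, of 0] label_h by blast
  have I_first: "i < j" if ij: "i \<in> ?I" "j \<in> {1..l} - ?I" for i j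
  proof -
    obtain d where d: "d \<in> initial_points R" "i = idx d" using ij(1) by blast
    obtain e where e: "e \<in> L" "j = idx e" using idx_surj[of j] ij(2) by blast
    obtain x where x: "x \<in> A (h 0)" "label (h 0) x = point_label e" using label_point[OF e(1)] by blast
    have "point_label e \<notin> point_label ` initial_points R"
      using idx_eq[OF e(1) inL] e(2) ij(2) by blast
    then have "Suc (h 0 + 2 * T) < point_label e" using label_not_initial[of "h 0" x] x by simp
    then show ?thesis using label_initial[OF d(1)] idx_less[of d e] inL d e by simp
  qed
  have F_last: "j < i" if ij: "i \<in> ?F" "j \<in> {1..l} - ?F" for i j
  proof -
    obtain d where d: "d \<in> initial_points (R\<inverse>) - initial_points R" "i = idx d" using ij(1) by blast
    obtain e where e: "e \<in> L" "j = idx e" using idx_surj[of j] ij(2) by blast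
    obtain x where x: "x \<in> A (h 0)" "label (h 0) x = point_label e" using label_point[OF e(1)] by blast
    have "point_label e \<notin> point_label ` (initial_points (R\<inverse>) - initial_points R)"
      using idx_eq[OF e(1) inL] e(2) ij(2) by blast
    then have "point_label e \<le> Suc (h 0 + 2 * U + 1)" using label_not_final[OF x(1)] x(2) by simp
    then show ?thesis using label_final[OF d(1)] idx_less[of e d] inL d e by simp
  qed
  have card_A': "card (A' k) = card L" for k using g by (rule bij_betw_same_card)
  have "fixed_size_frobenius_normal_form A' N' l B Q"
    unfolding fixed_size_frobenius_normal_form_def
  proof (intro conjI allI ballI)
    show "bounded_size A'" using finA' card_A' unfolding bounded_size_def by auto
    show "frobenius_normal_form A' N' (\<lambda>k. l) B Q" by (rule frob)
    show "\<exists>I F. extremal_choice (initial_columns N' B l) (final_rows N' B l) I F \<and>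
        (\<forall>i\<in>I. \<forall>j\<in>{1..l} - I. i < j) \<and> (\<forall>i\<in>F. \<forall>j\<in>{1..l} - F. j < i)"
      using choice I_first F_last by blast
    show "card (A' (Suc k)) = card (A' k)" for k by (simp add: card_A')
    show "card (B (Suc k) i) = card (B k i)" for k i by (simp add: card_B)
    show "B k i \<noteq> {}" if "i \<in> {1..l}" for k i using B_ne[OF that] .
    show "reduced (stream B i) N' \<and> primitive (stream B i) N' \<or>
        (\<forall>k. \<forall>x\<in>B k i. \<forall>y\<in>B (Suc k) i. N' k x y = 0)" for i
      using Q_prim nQ_zero by blast
  qed
  moreover have "gathering_times gather_times"
    unfolding gathering_times_def
  proof
    show "strict_mono gather_times"
      unfolding strict_mono_Suc_iff
    proof
      fix k
      show "gather_times k < gather_times (Suc k)"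
        using h_less[of k "Suc k"] h_ge[of "Suc k"] by (auto simp: gather_times_def)
    qed
  qed (simp add: gather_times_def)
  ultimately show ?thesis unfolding A'_def[abs_def] N'_def[abs_def] by blast
qed

end

section \<open>Eventual uniqueness of the primitive streams\<close>

text \<open>
  What a normal form says about the letters once the order is forgotten. It is phrased for a family of
  blocks in the original alphabets, so that two forms with different reorderings can be compared.
\<close>

locale stream_partition =
  fixes A :: "nat \<Rightarrow> 'a set" and N :: "nat \<Rightarrow> 'a \<Rightarrow> 'a \<Rightarrow> real"
    and S :: "nat \<Rightarrow> nat \<Rightarrow> 'a set" and P :: "nat set"
  assumes sub: "S k i \<subseteq> A k"
    and cover: "z \<in> A k \<Longrightarrow> \<exists>i. z \<in> S k i"
    and disj: "z \<in> S k i \<Longrightarrow> z \<in> S k j \<Longrightarrow> i = j"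
    and bounded: "\<exists>b. \<forall>k. \<forall>i>b. S k i = {}"
    and edge: "x \<in> S k i \<Longrightarrow> y \<in> S (Suc k) j \<Longrightarrow> 0 < N k x y \<Longrightarrow> i \<le> j"
    and finite_P: "finite P"
    and prim: "i \<in> P \<Longrightarrow> \<exists>s. \<forall>k\<ge>s. S k i \<noteq> {} \<and>
        (\<exists>n. \<forall>m\<ge>n. \<forall>x\<in>S k i. \<forall>y\<in>S m i. leads (\<lambda>k. S k i) N k m x y)"
    and pool: "i \<notin> P \<Longrightarrow>
        \<exists>n. \<forall>m\<ge>n. \<forall>x\<in>S k i. \<forall>y\<in>S m i. \<not> leads (\<lambda>k. S k i) N k m x y"

lemma (in stream_partition) label_mono:
  assumes "leads A N m n x y" "x \<in> S m i" "y \<in> S n j"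
  shows "i \<le> j"
proof -
  have "m \<le> n" using assms(1) by (rule leads_le)
  then show ?thesis using assms(1,3)
  proof (induction n arbitrary: y j rule: dec_induct)
    case base
    then show ?case using assms(2) disj by (auto simp: leads_same)
  next
    case (step n)
    obtain z where z: "leads A N m n x z" "leads A N n (Suc n) z y"
      using leads_split[OF step.prems(1) step.hyps(1)] by auto
    obtain l where l: "z \<in> S n l" using cover[OF leads_target[OF z(1)]] by blast
    have "i \<le> l" using step.IH[OF z(1) l] .
    moreover have "l \<le> j" using edge[OF l step.prems(2)] z(2) by (simp add: leads_edge)
    ultimately show ?case by simp
  qed
qed

text \<open>
  Take the largest label \<open>j\<close> of the second form that occurs along the stream \<open>i\<close>, at a letter
  \<open>x0\<close>. By primitivity \<open>x0\<close> leads to all letters of the stream at all late times, and labels do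
  not decrease, so all of these have label \<open>j\<close>.
\<close>

lemma stream_eventually_inside:
  assumes S: "stream_partition A N S P" and S': "stream_partition A N S' P'" and i: "i \<in> P"
  shows "\<exists>j\<in>P'. \<exists>K. \<forall>k\<ge>K. S k i \<noteq> {} \<and> S k i \<subseteq> S' k j"
proof -
  interpret S: stream_partition A N S P by (rule S)
  interpret S': stream_partition A N S' P' by (rule S')
  note sub = S.sub and cover = S'.cover
  obtain s where s: "\<And>k. s \<le> k \<Longrightarrow> S k i \<noteq> {}"
    "\<And>k. s \<le> k \<Longrightarrow> \<exists>n. \<forall>m\<ge>n. \<forall>x\<in>S k i. \<forall>y\<in>S m i. leads (\<lambda>k. S k i) N k m x y"
    using S.prim[OF i] by blast
  obtain b where b: "\<And>k l. l > b \<Longrightarrow> S' k l = {}"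
    using S'.bounded by blast
  define J where "J = {l. \<exists>k\<ge>s. S k i \<inter> S' k l \<noteq> {}}"
  have "l \<le> b" if l: "l \<in> J" for l
  proof (rule ccontr)
    assume "\<not> l \<le> b"
    then have "S' k l = {}" for k using b by simp
    with l show False by (simp add: J_def)
  qed
  then have finJ: "finite J" by (meson finite_nat_set_iff_bounded_le)
  obtain z where z: "z \<in> S s i" using s(1) by blast
  then obtain l where "z \<in> S' s l" using cover sub by blast
  with z have "J \<noteq> {}" unfolding J_def by blast
  define j where "j = Max J"
  have "j \<in> J" unfolding j_def using finJ \<open>J \<noteq> {}\<close> by (rule Max_in)
  then obtain k0 x0 where k0: "s \<le> k0" "x0 \<in> S k0 i" "x0 \<in> S' k0 j" by (auto simp: J_def)
  obtain n0 where n0: "\<And>m y. n0 \<le> m \<Longrightarrow> y \<in> S m i \<Longrightarrow> leads (\<lambda>k. S k i) N k0 m x0 y"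
    using s(2)[OF k0(1)] k0(2) by meson
  \<comment> \<open>From this time on \<open>x0\<close> reaches every letter of the stream.\<close>
  define K where "K = max s n0"
  have inside: "S k i \<subseteq> S' k j" if "K \<le> k" for k
  proof
    fix y assume y: "y \<in> S k i"
    obtain l where l: "y \<in> S' k l" using cover sub y by blast
    have "leads (\<lambda>k. S k i) N k0 k x0 y" using n0[OF _ y] that by (simp add: K_def)
    then have "leads A N k0 k x0 y" using sub by (rule leads_mono)
    then have "j \<le> l" using k0(3) l by (rule S'.label_mono)
    moreover have "l \<in> J" unfolding J_def using y l that by (auto simp: K_def)
    then have "l \<le> j" unfolding j_def using finJ by simp
    ultimately show "y \<in> S' k j" using l by simp
  qed
  have "j \<in> P'"
  proof (rule ccontr)
    assume "j \<notin> P'"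
    then obtain n where n: "\<And>m x y. n \<le> m \<Longrightarrow> x \<in> S' K j \<Longrightarrow> y \<in> S' m j \<Longrightarrow>
        \<not> leads (\<lambda>k. S' k j) N K m x y"
      using S'.pool by meson
    have "s \<le> K" by (simp add: K_def)
    then obtain n' where n': "\<And>m x y. n' \<le> m \<Longrightarrow> x \<in> S K i \<Longrightarrow> y \<in> S m i \<Longrightarrow>
        leads (\<lambda>k. S k i) N K m x y"
      using s(2) by meson
    define m where "m = max K (max n n')"
    have "S K i \<noteq> {}" "S m i \<noteq> {}" using s(1) by (simp_all add: K_def m_def)
    then obtain x y where xy: "x \<in> S K i" "y \<in> S m i" by blast
    have "leads (\<lambda>k. S k i) N K m x y" using n' xy by (simp add: m_def)
    then have "leads (\<lambda>k. S' k j) N K m x y"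
    proof (rule leads_restrict)
      fix t v assume v: "leads (\<lambda>k. S k i) N K t x v"
      show "v \<in> S' t j" using inside[OF leads_le[OF v]] leads_target[OF v] by blast
    qed
    moreover have "n \<le> m" "x \<in> S' K j" "y \<in> S' m j"
      using xy inside[of K] inside[of m] by (auto simp: m_def)
    ultimately show False using n by blast
  qed
  moreover have "S k i \<noteq> {} \<and> S k i \<subseteq> S' k j" if "K \<le> k" for k
    using s(1)[of k] inside[OF that] that by (simp add: K_def)
  ultimately show ?thesis by blast
qed

lemma stream_partitions_agree:
  assumes S: "stream_partition A N S P" and S': "stream_partition A N S' P'"
  shows "\<exists>\<sigma> K. bij_betw \<sigma> P P' \<and> (\<forall>k\<ge>K. \<forall>i\<in>P. S k i = S' k (\<sigma> i))"
proof -
  interpret S: stream_partition A N S P by (rule S)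
  interpret S': stream_partition A N S' P' by (rule S')
  obtain \<sigma> a where \<sigma>: "\<And>i. i \<in> P \<Longrightarrow> \<sigma> i \<in> P'"
    "\<And>i k. i \<in> P \<Longrightarrow> a i \<le> k \<Longrightarrow> S k i \<noteq> {} \<and> S k i \<subseteq> S' k (\<sigma> i)"
    using stream_eventually_inside[OF S S'] by metis
  obtain \<tau> a' where \<tau>: "\<And>j. j \<in> P' \<Longrightarrow> \<tau> j \<in> P"
    "\<And>j k. j \<in> P' \<Longrightarrow> a' j \<le> k \<Longrightarrow> S' k j \<noteq> {} \<and> S' k j \<subseteq> S k (\<tau> j)"
    using stream_eventually_inside[OF S' S] by metis
  define K where "K = Max (insert 0 (a ` P \<union> a' ` P'))"
  have K: "a i \<le> k" if "i \<in> P" "K \<le> k" for i k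
    using that S.finite_P S'.finite_P by (auto simp: K_def)
  have K': "a' j \<le> k" if "j \<in> P'" "K \<le> k" for j k
    using that S.finite_P S'.finite_P by (auto simp: K_def)
  have inv: "\<tau> (\<sigma> i) = i" if i: "i \<in> P" for i
  proof -
    have "S K i \<noteq> {}" "S K i \<subseteq> S K (\<tau> (\<sigma> i))"
      using \<sigma>(2)[OF i K[OF i]] \<tau>(2)[OF \<sigma>(1)[OF i] K'[OF \<sigma>(1)[OF i]]] by blast+
    then show ?thesis using S.disj by blast
  qed
  have inv': "\<sigma> (\<tau> j) = j" if j: "j \<in> P'" for j
  proof -
    have "S' K j \<noteq> {}" "S' K j \<subseteq> S' K (\<sigma> (\<tau> j))"
      using \<tau>(2)[OF j K'[OF j]] \<sigma>(2)[OF \<tau>(1)[OF j] K[OF \<tau>(1)[OF j]]] by blast+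
    then show ?thesis using S'.disj by blast
  qed
  have "bij_betw \<sigma> P P'"
    using inv inv' \<sigma>(1) \<tau>(1) by (intro bij_betw_byWitness[of P \<tau>]) auto
  moreover have "S k i = S' k (\<sigma> i)" if "i \<in> P" "K \<le> k" for k i
    using \<sigma>(2)[OF that(1) K[OF that]] \<tau>(2)[OF \<sigma>(1)[OF that(1)] K'[OF \<sigma>(1)[OF that(1)] that(2)]]
      inv[OF that(1)] by auto
  ultimately show ?thesis by blast
qed

lemma frobenius_block_subset:
  assumes "frobenius_normal_form A N lh blk P"
  shows "blk k i \<subseteq> A k"
proof -
  have "(\<Union>i\<in>{1..lh k}. blk k i) = A k" "i \<notin> {1..lh k} \<Longrightarrow> blk k i = {}"
    using assms by (simp_all add: frobenius_normal_form_def block_structure_def)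
  then show ?thesis by blast
qed

text \<open>
  Primitivity provides a positive product over one interval of times only. As the columns of a
  reduced block do not vanish, paths into that interval's end extend to paths into every letter at any
  later time, which is the form of primitivity used for the comparison.
\<close>

lemma frobenius_stream_partition:
  assumes mat: "matrix_sequence A N" and e: "reordering A e" and b: "\<And>k. lh k \<le> b"
    and form: "frobenius_normal_form (positions A) (reordered e N) lh blk P"
  shows "stream_partition A N (\<lambda>k i. e k ` blk k i) P"
proof -
  have bij: "bij_betw (e k) (positions A k) (A k)" for k
    using e by (simp add: reordering_def positions_def)
  have inj: "inj_on (e k) (positions A k)" and img: "e k ` positions A k = A k" for k
    using bij by (auto simp: bij_betw_def)
  have nonneg: "0 \<le> reordered e N k x y" if "x \<in> positions A k" "y \<in> positions A (Suc k)" for k x y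
    using mat imageI[OF that(1), of "e k"] imageI[OF that(2), of "e (Suc k)"]
    by (simp add: img matrix_sequence_def reordered_def)
  have union: "(\<Union>i\<in>{1..lh k}. blk k i) = positions A k"
    and disj: "disjoint_family_on (blk k) {1..lh k}"
    and empty: "\<And>i. i \<notin> {1..lh k} \<Longrightarrow> blk k i = {}" for k
    using form by (simp_all add: frobenius_normal_form_def block_structure_def)
  have sub: "blk k i \<subseteq> positions A k" for k i using form by (rule frobenius_block_subset)
  have fin: "finite (blk k i)" for k i
    using sub by (rule finite_subset) (simp add: positions_def)
  have nonneg_blk: "0 \<le> reordered e N k x y" if "x \<in> blk k i" "y \<in> blk (Suc k) j" for k i j x y
    using nonneg sub that by blast
  have disj': "x \<in> blk k i \<Longrightarrow> x \<in> blk k j \<Longrightarrow> i = j" for x k i j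
    using disj[of k] empty[of _ k] unfolding disjoint_family_on_def by blast
  have relabel: "leads (\<lambda>k. blk k i) (reordered e N) m n x y \<longleftrightarrow>
      leads (\<lambda>k. e k ` blk k i) N m n (e m x) (e n y)"
    if "x \<in> blk m i" "y \<in> blk n i" for i m n x y
    using that inj sub by (intro leads_relabel) (auto intro: inj_on_subset[OF inj sub])
  have P_sub: "P \<subseteq> (\<Union>k. {1..lh k})"
    and prim: "\<And>i. i \<in> P \<Longrightarrow> \<exists>s. primitive_from (reordered e N) blk i s"
    and pool: "\<And>i. i \<in> (\<Union>k. {1..lh k}) - P \<Longrightarrow> pool_block (reordered e N) blk i"
    and zero: "\<And>k i j. i \<in> {1..lh k} \<Longrightarrow> j \<in> {1..lh (Suc k)} \<Longrightarrow> j < i \<Longrightarrow>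
      block_matrix (reordered e N) blk k i j = 0"
    using form by (simp_all add: frobenius_normal_form_def)
  have "(\<Union>k. {1..lh k}) \<subseteq> {1..b}" using order_trans[OF _ b] by auto
  with P_sub have "P \<subseteq> {1..b}" by (rule order_trans)
  then have finP: "finite P" by (rule finite_subset) simp
  show ?thesis
  proof
    show "e k ` blk k i \<subseteq> A k" for k i using sub img by blast
    show "\<exists>i. z \<in> e k ` blk k i" if "z \<in> A k" for k z
    proof -
      have "z \<in> e k ` (\<Union>i\<in>{1..lh k}. blk k i)" using that by (simp only: union img)
      then show ?thesis by blast
    qed
    show "i = j" if z: "z \<in> e k ` blk k i" "z \<in> e k ` blk k j" for z k i j
    proof -
      obtain p q where "p \<in> blk k i" "z = e k p" "q \<in> blk k j" "z = e k q" using z by blast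
      moreover from this have "p = q" using inj_onD[OF inj, of k p q] sub by auto
      ultimately show ?thesis using disj' by blast
    qed
    show "\<exists>b. \<forall>k. \<forall>i>b. e k ` blk k i = {}"
    proof (intro exI[of _ b] allI impI)
      fix k i assume "i > b"
      then have "i \<notin> {1..lh k}" using b[of k] by simp
      then show "e k ` blk k i = {}" using empty by simp
    qed
    show "finite P" by (rule finP)
    show "i \<le> j" if xy: "x \<in> e k ` blk k i" "y \<in> e (Suc k) ` blk (Suc k) j" "0 < N k x y" for k i j x y
    proof (rule ccontr)
      assume "\<not> i \<le> j"
      obtain p q where pq: "p \<in> blk k i" "x = e k p" "q \<in> blk (Suc k) j" "y = e (Suc k) q"
        using xy by blast
      then have "\<exists>p\<in>blk k i. \<exists>q\<in>blk (Suc k) j. reordered e N k p q \<noteq> 0"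
        using xy(3) by (intro bexI[of _ p] bexI[of _ q]) (auto simp: reordered_def)
      then have "block_matrix (reordered e N) blk k i j \<noteq> 0" by (simp add: block_matrix_def)
      moreover have "i \<in> {1..lh k}" "j \<in> {1..lh (Suc k)}" using pq empty by blast+
      ultimately show False using zero \<open>\<not> i \<le> j\<close> by simp
    qed
    show "\<exists>n. \<forall>m\<ge>n. \<forall>x\<in>e k ` blk k i. \<forall>y\<in>e m ` blk m i. \<not> leads (\<lambda>k. e k ` blk k i) N k m x y"
      if i: "i \<notin> P" for i k
    proof (cases "i \<in> (\<Union>k. {1..lh k})")
      case False
      then have "blk k i = {}" using empty by blast
      then show ?thesis by simp
    next
      case True
      then have "pool_block (reordered e N) blk i" using pool i by blast
      then obtain n where n: "k < n" "\<And>m. n \<le> m \<Longrightarrow> blk k i = {} \<or> blk (Suc m) i = {} \<or>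
          (\<forall>x\<in>blk k i. \<forall>y\<in>blk (Suc m) i. seq_prod (stream blk i) (reordered e N) k m x y = 0)"
        unfolding pool_block_def by blast
      have "\<not> leads (\<lambda>k. e k ` blk k i) N k m x y"
        if m: "Suc n \<le> m" and xy: "x \<in> e k ` blk k i" "y \<in> e m ` blk m i" for m x y
      proof -
        obtain p q where pq: "p \<in> blk k i" "x = e k p" "q \<in> blk m i" "y = e m q" using xy by blast
        obtain m' where m': "m = Suc m'" "n \<le> m'" using m by (cases m) auto
        have "seq_prod (\<lambda>k. blk k i) (reordered e N) k m' p q = 0"
          using n(2)[OF m'(2)] pq m'(1) by (auto simp: stream_def[abs_def])
        then have "\<not> leads (\<lambda>k. blk k i) (reordered e N) k m p q"
          using seq_prod_zero_iff_not_leads[of "\<lambda>k. blk k i" "reordered e N" p k q m']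
            fin nonneg_blk pq m' n(1) by simp
        then show ?thesis using relabel[OF pq(1,3)] pq by simp
      qed
      then show ?thesis by blast
    qed
    show "\<exists>s. \<forall>k\<ge>s. e k ` blk k i \<noteq> {} \<and> (\<exists>n. \<forall>m\<ge>n. \<forall>x\<in>e k ` blk k i. \<forall>y\<in>e m ` blk m i.
        leads (\<lambda>k. e k ` blk k i) N k m x y)"
      if i: "i \<in> P" for i
    proof -
      obtain s where "primitive_from (reordered e N) blk i s" using prim[OF i] by blast
      then have ne: "\<And>k. s \<le> k \<Longrightarrow> blk k i \<noteq> {}"
        and red: "reduced (\<lambda>k. blk (s + k) i) (\<lambda>k. reordered e N (s + k))"
        and pr: "primitive (\<lambda>k. blk (s + k) i) (\<lambda>k. reordered e N (s + k))"
        unfolding primitive_from_def by blast+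
      have "\<exists>n. \<forall>m\<ge>n. \<forall>x\<in>blk k i. \<forall>y\<in>blk m i. leads (\<lambda>k. blk k i) (reordered e N) k m x y"
        if "s \<le> k" for k
      proof -
        obtain k' where k': "k = s + k'" using \<open>s \<le> k\<close> le_Suc_ex by blast
        obtain n where n: "k' < n" "\<And>x y. x \<in> blk k i \<Longrightarrow> y \<in> blk (s + Suc n) i \<Longrightarrow>
            0 < seq_prod (\<lambda>k. blk (s + k) i) (\<lambda>k. reordered e N (s + k)) k' n x y"
          using pr unfolding primitive_def k' by blast
        have "leads (\<lambda>k. blk k i) (reordered e N) k m x y"
          if m: "s + Suc n \<le> m" and xy: "x \<in> blk k i" "y \<in> blk m i" for m x y
        proof -
          have pred: "\<exists>x\<in>blk k i. reordered e N k x y \<noteq> 0"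
            if "s + Suc n \<le> k" "y \<in> blk (Suc k) i" for k y
          proof -
            obtain r where "k = s + r" using \<open>s + Suc n \<le> k\<close> le_Suc_ex[of s k] by auto
            then show ?thesis using red that unfolding reduced_def by auto
          qed
          obtain v where v: "leads (\<lambda>k. blk k i) (reordered e N) (s + Suc n) m v y"
            using reduced_leads_backward[of "\<lambda>k. blk k i" "reordered e N" "s + Suc n" y m]
              nonneg_blk pred xy(2) m by blast
          then have "v \<in> blk (s + Suc n) i" by (rule leads_source)
          then have "leads (\<lambda>k. blk (s + k) i) (\<lambda>k. reordered e N (s + k)) k' (Suc n) x v"
            using seq_prod_positive_iff_leads[of "\<lambda>k. blk (s + k) i" "\<lambda>k. reordered e N (s + k)"
                x k' v n] n xy(1) fin nonneg_blk k' by simp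
          then have "leads (\<lambda>k. blk k i) (reordered e N) k (s + Suc n) x v"
            unfolding k' by (simp only: leads_shift[of "\<lambda>k. blk k i"])
          then show ?thesis using v by (rule leads_trans)
        qed
        then show ?thesis by blast
      qed
      then have "\<exists>n. \<forall>m\<ge>n. \<forall>x\<in>e k ` blk k i. \<forall>y\<in>e m ` blk m i.
          leads (\<lambda>k. e k ` blk k i) N k m x y" if "s \<le> k" for k
        using that relabel by (simp add: Ball_image_comp o_def)
      with ne show ?thesis by blast
    qed
  qed
qed

text \<open>
  The permutation of positions is forced: it sends the position of a letter in the first reordering to
  its position in the second.
\<close>

lemma frobenius_form_unique:
  assumes mat: "matrix_sequence A N"
    and e: "reordering A e" "\<And>k. lh k \<le> b"
      "frobenius_normal_form (positions A) (reordered e N) lh blk P"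
    and e': "reordering A e'" "\<And>k. lh' k \<le> b'"
      "frobenius_normal_form (positions A) (reordered e' N) lh' blk' P'"
  shows "\<exists>K. agree_up_to_permutation A N e blk P e' blk' P' K"
proof -
  have S: "stream_partition A N (\<lambda>k i. e k ` blk k i) P"
    using mat e by (rule frobenius_stream_partition)
  have S': "stream_partition A N (\<lambda>k i. e' k ` blk' k i) P'"
    using mat e' by (rule frobenius_stream_partition)
  from stream_partitions_agree[OF S S'] obtain \<sigma> K where \<sigma>: "bij_betw \<sigma> P P'"
    and agree: "\<forall>k\<ge>K. \<forall>i\<in>P. e k ` blk k i = e' k ` blk' k (\<sigma> i)"
    by (elim exE conjE)
  have eq: "e k ` blk k i = e' k ` blk' k (\<sigma> i)" if "K \<le> k" "i \<in> P" for k i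
    using agree that by simp
  have bij: "bij_betw (e k) (positions A k) (A k)" and bij': "bij_betw (e' k) (positions A k) (A k)" for k
    using e(1) e'(1) by (simp_all add: reordering_def positions_def)
  have sub: "blk k i \<subseteq> positions A k" for k i
    using e(3) by (rule frobenius_block_subset)
  have sub': "blk' k i \<subseteq> positions A k" for k i
    using e'(3) by (rule frobenius_block_subset)
  define \<pi> where "\<pi> k x = (if x \<in> positions A k then inv_into (positions A k) (e' k) (e k x) else x)" for k x
  have \<pi>: "\<pi> k x \<in> positions A k" "e' k (\<pi> k x) = e k x" if "x \<in> positions A k" for k x
  proof -
    have "e k x \<in> e' k ` positions A k" using bij bij' that by (auto simp: bij_betw_def)
    then show "\<pi> k x \<in> positions A k" "e' k (\<pi> k x) = e k x"
      using that unfolding \<pi>_def by (simp_all add: inv_into_into f_inv_into_f)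
  qed
  have "\<pi> k permutes positions A k" for k
  proof (rule bij_imp_permutes)
    have "inj_on (\<pi> k) (positions A k)"
    proof (rule inj_onI)
      fix x y assume "x \<in> positions A k" "y \<in> positions A k" "\<pi> k x = \<pi> k y"
      then show "x = y" using \<pi>(2) inj_onD[OF bij_betw_imp_inj_on[OF bij]] by metis
    qed
    then show "bij_betw (\<pi> k) (positions A k) (positions A k)"
      using \<pi>(1) unfolding bij_betw_def
      by (intro conjI endo_inj_surj) (auto simp: positions_def)
  qed (simp add: \<pi>_def)
  moreover have "\<pi> k ` blk k i = blk' k (\<sigma> i)" if "K \<le> k" "i \<in> P" for k i
  proof -
    have "e' k ` \<pi> k ` blk k i = e k ` blk k i"
      unfolding image_image using \<pi>(2) sub[of k i] by (intro image_cong) auto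
    also have "\<dots> = e' k ` blk' k (\<sigma> i)" using eq[OF that] .
    finally show ?thesis
      using inj_on_image_eq_iff[of "e' k" "positions A k" "\<pi> k ` blk k i" "blk' k (\<sigma> i)"]
        bij'[of k] \<pi>(1)[of _ k] sub[of k i] sub'[of k "\<sigma> i"]
      by (auto simp: bij_betw_def image_subset_iff)
  qed
  ultimately show ?thesis
    unfolding agree_up_to_permutation_def using \<sigma> \<pi>(2)
    by (intro exI[of _ K] exI[of _ \<pi>] exI[of _ \<sigma>]) (simp add: reordered_def)
qed

section \<open>Sorting the alphabets\<close>

lemma sorting_reordering:
  fixes f :: "nat \<Rightarrow> 'a \<Rightarrow> nat"
  assumes "\<And>k. finite (A k)"
  obtains e where "reordering A e"
    "\<And>k x y. x \<in> positions A k \<Longrightarrow> y \<in> positions A k \<Longrightarrow> f k (e k x) < f k (e k y) \<Longrightarrow> x < y"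
proof -
  have "\<exists>g. bij_betw g {1..card (A k)} (A k) \<and>
      (\<forall>x\<in>{1..card (A k)}. \<forall>y\<in>{1..card (A k)}. f k (g x) < f k (g y) \<longrightarrow> x < y)" for k
  proof -
    obtain xs where xs: "set xs = A k" "distinct xs"
      using finite_distinct_list[OF assms] by blast
    define ys where "ys = sort_key (f k) xs"
    have ys: "set ys = A k" "distinct ys" "length ys = card (A k)" "sorted (map (f k) ys)"
      using xs distinct_card[OF xs(2)] by (simp_all add: ys_def)
    \<comment> \<open>Positions are counted from \<open>1\<close>, list indices from \<open>0\<close>.\<close>
    have "bij_betw (\<lambda>x. x - 1) {1..card (A k)} {..<card (A k)}"
      by (rule bij_betw_byWitness[where f' = Suc]) auto
    moreover have "bij_betw ((!) ys) {..<card (A k)} (A k)"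
      by (rule bij_betw_nth) (simp_all only: ys)
    ultimately have "bij_betw ((!) ys \<circ> (\<lambda>x. x - 1)) {1..card (A k)} (A k)"
      by (rule bij_betw_trans)
    moreover have "x < y"
      if "x \<in> {1..card (A k)}" "y \<in> {1..card (A k)}" "f k (ys ! (x - 1)) < f k (ys ! (y - 1))" for x y
    proof (rule ccontr)
      assume "\<not> x < y"
      then have "y - 1 \<le> x - 1" "x - 1 < length ys" using that(1,2) ys(3) by auto
      then have "f k (ys ! (y - 1)) \<le> f k (ys ! (x - 1))"
        using sorted_nth_mono[OF ys(4), of "y - 1" "x - 1"] by simp
      with that(3) show False by simp
    qed
    ultimately show ?thesis by (intro exI[of _ "(!) ys \<circ> (\<lambda>x. x - 1)"]) (simp add: o_def)
  qed
  then obtain e where "\<And>k. bij_betw (e k) {1..card (A k)} (A k) \<and>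
      (\<forall>x\<in>{1..card (A k)}. \<forall>y\<in>{1..card (A k)}. f k (e k x) < f k (e k y) \<longrightarrow> x < y)"
    by metis
  then show ?thesis by (intro that[of e]) (auto simp: reordering_def positions_def)
qed

text \<open>
  The labels are computed from the original letters before any order exists. This shows that the
  reordered sequence, with the numberings carried along, produces the same labels.
\<close>

lemma (in ramsey_frame) positions_frame:
  assumes e: "reordering A e"
  shows "ramsey_frame (positions A) (reordered e N) h (\<lambda>i x. c i (e (h i) x)) L R rank T U"
    and "x \<in> positions A k \<Longrightarrow>
      ramsey_frame.label (positions A) (reordered e N) h (\<lambda>i x. c i (e (h i) x)) R rank T k x =
      label k (e k x)"
proof -
  have bij: "bij_betw (e k) (positions A k) (A k)" for k
    using e by (simp add: reordering_def positions_def)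
  have inj: "inj_on (e k) (positions A k)" and img: "e k ` positions A k = A k" for k
    using bij by (auto simp: bij_betw_def)
  have e_in: "x \<in> positions A k \<Longrightarrow> e k x \<in> A k" for k x using img by blast
  have leads_e: "leads (positions A) (reordered e N) m n x y \<longleftrightarrow> leads A N m n (e m x) (e n y)"
    if "x \<in> positions A m" "y \<in> positions A n" for m n x y
    using img inj that by (rule leads_relabel)
  have surj: "\<exists>p\<in>positions A k. z = e k p" if "z \<in> A k" for k z using that img[of k] by blast
  interpret Q: ramsey_frame "positions A" "reordered e N" h "\<lambda>i x. c i (e (h i) x)" L R rank T U
  proof
    show "matrix_sequence (positions A) (reordered e N)"
      unfolding matrix_sequence_def reordered_def
    proof (intro conjI allI ballI)
      fix k
      have "A k \<noteq> {}" using matrix by (simp add: matrix_sequence_def)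
      then show "positions A k \<noteq> {}" using img[of k] by blast
    qed (auto simp: positions_def[of A] intro!: nonneg e_in[unfolded positions_def])
    show "reduced (positions A) (reordered e N)"
      unfolding reduced_def reordered_def
    proof (intro allI conjI ballI)
      show "\<exists>y\<in>positions A (Suc k). N k (e k x) (e (Suc k) y) \<noteq> 0" if "x \<in> positions A k" for k x
        using red e_in[OF that] surj[of _ "Suc k"] unfolding reduced_def by metis
      show "\<exists>x\<in>positions A k. N k (e k x) (e (Suc k) y) \<noteq> 0" if "y \<in> positions A (Suc k)" for k y
        using red e_in[OF that] surj[of _ k] unfolding reduced_def by metis
    qed
    show "bij_betw (\<lambda>x. c i (e (h i) x)) (positions A (h i)) L" for i
      using bij_betw_trans[OF bij c_bij] by (simp add: o_def)
    show "leads (positions A) (reordered e N) (h i) (h j) x y \<longleftrightarrow>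
        (c i (e (h i) x), c j (e (h j) y)) \<in> R"
      if "i < j" "x \<in> positions A (h i)" "y \<in> positions A (h j)" for i j x y
      using that leads_e leads_iff e_in by simp
  qed (use h_mono finite_L R_sub trans_rel_R rank_mono rank_eq rank_initial rank_not_initial rank_final
      rank_not_final T_le_U in simp_all)
  show "ramsey_frame (positions A) (reordered e N) h (\<lambda>i x. c i (e (h i) x)) L R rank T U"
    by (rule Q.ramsey_frame_axioms)
  assume x: "x \<in> positions A k"
  have pre: "Q.pre k x = pre k (e k x)"
  proof (intro set_eqI iffI)
    fix d assume "d \<in> Q.pre k x"
    then obtain p where p: "d = c (window k) (e (h (window k)) p)"
      "leads (positions A) (reordered e N) (h (window k)) k p x" unfolding Q.pre_def by blast
    then show "d \<in> pre k (e k x)"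
      using leads_e[OF leads_source[OF p(2)] x] unfolding pre_def by blast
  next
    fix d assume "d \<in> pre k (e k x)"
    then obtain y where y: "d = c (window k) y" "leads A N (h (window k)) k y (e k x)"
      unfolding pre_def by blast
    obtain p where p: "p \<in> positions A (h (window k))" "y = e (h (window k)) p"
      using surj[OF leads_source[OF y(2)]] by blast
    then show "d \<in> Q.pre k x" using y leads_e[OF p(1) x] unfolding Q.pre_def by blast
  qed
  have post: "Q.post k x = post k (e k x)"
  proof (intro set_eqI iffI)
    fix d assume "d \<in> Q.post k x"
    then obtain p where p: "d = c (Suc (window k)) (e (h (Suc (window k))) p)"
      "leads (positions A) (reordered e N) k (h (Suc (window k))) x p" unfolding Q.post_def by blast
    then show "d \<in> post k (e k x)"
      using leads_e[OF x leads_target[OF p(2)]] unfolding post_def by blast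
  next
    fix d assume "d \<in> post k (e k x)"
    then obtain y where y: "d = c (Suc (window k)) y" "leads A N k (h (Suc (window k))) (e k x) y"
      unfolding post_def by blast
    obtain p where p: "p \<in> positions A (h (Suc (window k)))" "y = e (h (Suc (window k))) p"
      using surj[OF leads_target[OF y(2)]] by blast
    then show "d \<in> Q.post k x" using y leads_e[OF x p(1)] unfolding Q.post_def by blast
  qed
  show "Q.label k x = label k (e k x)"
    unfolding Q.label_def label_def Q.core_def core_def pre post ..
qed

lemma frobenius_form_exists:
  assumes "matrix_sequence A N" "bounded_size A" "reduced A N"
  shows "\<exists>e lh blk P. reordering A e \<and> (\<exists>b. \<forall>k. lh k \<le> b) \<and>
      frobenius_normal_form (positions A) (reordered e N) lh blk P \<and>
      initial_first_final_last (positions A) (reordered e N) blk P \<and>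
      (\<exists>t l blk' P'. gathering_times t \<and>
         fixed_size_frobenius_normal_form (\<lambda>k. positions A (t (Suc k)))
           (\<lambda>k. gathered (positions A) (reordered e N) t (Suc k)) l blk' P')"
proof -
  obtain h :: "nat \<Rightarrow> nat" and c R and L :: "nat set" where frame: "strict_mono h" "finite L" "R \<subseteq> L \<times> L" "trans R"
    "\<And>i. bij_betw (c i) (A (h i)) L"
    "\<And>i j x y. i < j \<Longrightarrow> x \<in> A (h i) \<Longrightarrow> y \<in> A (h j) \<Longrightarrow>
       leads A N (h i) (h j) x y \<longleftrightarrow> (c i x, c j y) \<in> R"
    by (rule ramsey_times[OF assms]) (rule that; assumption)
  from frame(4)
  obtain rank :: "nat \<Rightarrow> nat" and T U where rank: "\<And>d e. (d, e) \<in> R \<Longrightarrow> rank d \<le> rank e"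
    "\<And>d e. d \<in> L \<Longrightarrow> e \<in> L \<Longrightarrow> rank d = rank e \<Longrightarrow> d = e \<or> (d, e) \<in> R \<and> (e, d) \<in> R"
    "\<And>d. d \<in> L \<Longrightarrow> d \<in> initial_points R \<Longrightarrow> rank d < T"
    "\<And>d. d \<in> L \<Longrightarrow> d \<notin> initial_points R \<Longrightarrow> T < rank d"
    "\<And>d. d \<in> L \<Longrightarrow> d \<in> initial_points (R\<inverse>) - initial_points R \<Longrightarrow> U < rank d"
    "\<And>d. d \<in> L \<Longrightarrow> d \<notin> initial_points (R\<inverse>) - initial_points R \<Longrightarrow> rank d < U"
    "T \<le> U"
    by (rule linear_extension_of_transitive_relation[OF frame(2,3)]) (rule that; assumption)
  interpret F: ramsey_frame A N h c L R rank T U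
    using assms(1,3) frame rank by unfold_locales
  obtain e where e: "reordering A e"
    "\<And>k x y. x \<in> positions A k \<Longrightarrow> y \<in> positions A k \<Longrightarrow>
      F.label k (e k x) < F.label k (e k y) \<Longrightarrow> x < y"
    by (rule sorting_reordering[OF F.finite_A, where f = F.label]) (rule that; assumption)
  interpret Q: ramsey_frame "positions A" "reordered e N" h "\<lambda>i x. c i (e (h i) x)" L R rank T U
    by (rule F.positions_frame(1)[OF e(1)])
  interpret O: ordered_frame "positions A" "reordered e N" h "\<lambda>i x. c i (e (h i) x)" L R rank T U
    by unfold_locales (simp add: F.positions_frame(2)[OF e(1)] e(2))
  show ?thesis
    by (rule exI[of _ e], rule exI[of _ "\<lambda>k. O.block_count"], rule exI[of _ O.blk],
        rule exI[of _ O.stream_labels],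
        intro conjI e(1) O.frobenius O.initial_first O.fixed_size) auto
qed

theorem theorem3p11:
  fixes A :: "nat \<Rightarrow> 'a set" and N :: "nat \<Rightarrow> 'a \<Rightarrow> 'a \<Rightarrow> real"
  assumes "matrix_sequence A N"
    and "bounded_size A"
    and "reduced A N"
  shows
    "(\<exists>e lh blk P.
        reordering A e \<and>
        (\<exists>b. \<forall>k. lh k \<le> b) \<and>
        frobenius_normal_form (positions A) (reordered e N) lh blk P \<and>
        initial_first_final_last (positions A) (reordered e N) blk P \<and>
        (\<exists>t l blk' P'.
           gathering_times t \<and>
           fixed_size_frobenius_normal_form
             (\<lambda>k. positions A (t (Suc k)))
             (\<lambda>k. gathered (positions A) (reordered e N) t (Suc k)) l blk' P')) \<and>
     (\<forall>e lh blk P e' lh' blk' P'.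
        reordering A e \<longrightarrow> (\<exists>b. \<forall>k. lh k \<le> b) \<longrightarrow>
        frobenius_normal_form (positions A) (reordered e N) lh blk P \<longrightarrow>
        reordering A e' \<longrightarrow> (\<exists>b. \<forall>k. lh' k \<le> b) \<longrightarrow>
        frobenius_normal_form (positions A) (reordered e' N) lh' blk' P' \<longrightarrow>
        (\<exists>K. agree_up_to_permutation A N e blk P e' blk' P' K))"
proof (intro conjI allI impI)
  show "\<exists>e lh blk P. reordering A e \<and> (\<exists>b. \<forall>k. lh k \<le> b) \<and>
      frobenius_normal_form (positions A) (reordered e N) lh blk P \<and>
      initial_first_final_last (positions A) (reordered e N) blk P \<and>
      (\<exists>t l blk' P'. gathering_times t \<and>
         fixed_size_frobenius_normal_form (\<lambda>k. positions A (t (Suc k)))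
           (\<lambda>k. gathered (positions A) (reordered e N) t (Suc k)) l blk' P')"
    using assms by (rule frobenius_form_exists)
next
  fix e lh blk P e' lh' blk' P'
  assume e: "reordering A e" "\<exists>b. \<forall>k. lh k \<le> b"
    "frobenius_normal_form (positions A) (reordered e N) lh blk P"
    and e': "reordering A e'" "\<exists>b. \<forall>k. lh' k \<le> b"
    "frobenius_normal_form (positions A) (reordered e' N) lh' blk' P'"
  from e(2) e'(2) obtain b b' where b: "\<And>k. lh k \<le> b" "\<And>k. lh' k \<le> b'" by blast
  show "\<exists>K. agree_up_to_permutation A N e blk P e' blk' P' K"
    using assms(1) e(1) b(1) e(3) e'(1) b(2) e'(3) by (rule frobenius_form_unique)
qed

end
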